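(* Assume the Setup below, let $a,b\in\mathbb{R}$ be constants, and let the ridge statistic be either $\hat\alpha=c$ or $\hat\alpha=c\,\mathrm{tr}(W)$ for a constant $c>0$, with $c_0=0$ in the first case and $c_0=c$ in the second. Define $$\hat\Delta_{a,b}=\mathrm{tr}(V^2W)a^2+2\frac{\mathrm{tr}(VW)}{\mathrm{tr}(W)}ab+\frac{b^2}{\mathrm{tr}(W)}-2(n-p-1)\mathrm{tr}(V)a-2\frac{(n-1)pb}{\mathrm{tr}(W)}-2\hat\alpha(\mathrm{tr}V)^2a+2(2c_0+1)\mathrm{tr}(V^2W)a+\frac{4b}{\mathrm{tr}(W)}.$$ Then $\hat\Delta_{a,b}$ is an unbiased estimator of the risk difference, i.e. for every $\Theta$, $$E[\hat\Delta_{a,b}]=np\{R(\Theta,\hat\Theta^{RLS}_{a,b})-R(\Theta,X)\}.$$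
   Context: Setup. Let $n\ge 2$, $p\ge1$. Let $X=(x_1,\dots,x_n)$ be a random $p\times n$ matrix whose columns are independent with $x_i\sim\mathcal N_p(\theta_i,\Sigma)$, where $\Sigma$ is a known $p\times p$ positive definite matrix and $\Theta=(\theta_1,\dots,\theta_n)\in\mathbb R^{p\times n}$ is the unknown mean matrix. The loss of an estimator $\hat\Theta$ is $L(\Theta,\hat\Theta)=\frac{1}{np}\mathrm{tr}[(\hat\Theta-\Theta)^\top\Sigma^{-1}(\hat\Theta-\Theta)]$ and its risk is $R(\Theta,\hat\Theta)=E[L(\Theta,\hat\Theta)]$; in particular $R(\Theta,X)=1$ for all $\Theta$. Let $\bar x=n^{-1}\sum_{j=1}^n x_j$, $\bar X=\bar x\,1_n^\top$ with $1_n=(1,\dots,1)^\top\in\mathbb R^n$, and $W=(X-\bar X)(X-\bar X)^\top\Sigma^{-1}$. For a nonnegative scalar statistic $\hat\alpha$ (a function of $W$) put $V=(W+\hat\alpha I_p)^{-1}$. For weights $a,b$ the ridge-type linear shrinkage estimator is $$\hat\Theta^{RLS}_{a,b}=X-\Big\{aV+\frac{b}{\mathrm{tr}(W)}I_p\Big\}(X-\bar X).$$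
   Formalization: The formal theorem also assumes that Δ̂ and the loss of the RLS estimator have finite expectation; this is automatic for p(n−1) ≥ 3, but the claim fails without it, e.g. p=1, n=2, a=0, b=−2 gives Δ̂=0 while the risk is infinite. *)

theory Defs
  imports "HOL-Analysis.Analysis"
begin

text \<open>A p x n matrix is an element of type real^'n^'p (rows indexed by 'p,
  columns by 'n); X $ i $ j is the entry in row i, column j.\<close>

definition pos_def_mat :: "real^'p^'p \<Rightarrow> bool" where
  "pos_def_mat S \<longleftrightarrow> transpose S = S \<and> (\<forall>x. x \<noteq> 0 \<longrightarrow> x \<bullet> (S *v x) > 0)"

text \<open>Joint density of X = (x_1,...,x_n) with independent columns x_i ~ N_p(theta_i, Sigma):
  the product of the n multivariate normal densities.\<close>
definition matnormal_density :: "real^'n^'p \<Rightarrow> real^'p^'p \<Rightarrow> real^'n^'p \<Rightarrow> real" where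
  "matnormal_density Th S X =
     (\<Prod>j\<in>UNIV. (2 * pi) powr (- real CARD('p) / 2) * det S powr (- 1 / 2) *
        exp (- (1 / 2) * ((column j X - column j Th) \<bullet> (matrix_inv S *v (column j X - column j Th)))))"

definition matnormal :: "real^'n^'p \<Rightarrow> real^'p^'p \<Rightarrow> (real^'n^'p) measure" where
  "matnormal Th S = density lborel (\<lambda>X. ennreal (matnormal_density Th S X))"

definition Xbar :: "real^'n^'p \<Rightarrow> real^'n^'p" where
  "Xbar X = (\<chi> i j. (\<Sum>k\<in>UNIV. X $ i $ k) / real CARD('n))"

definition Wmat :: "real^'p^'p \<Rightarrow> real^'n^'p \<Rightarrow> real^'p^'p" where
  "Wmat S X = ((X - Xbar X) ** transpose (X - Xbar X)) ** matrix_inv S"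

definition Vmat :: "real \<Rightarrow> real^'p^'p \<Rightarrow> real^'p^'p" where
  "Vmat al W = matrix_inv (W + al *\<^sub>R mat 1)"

definition RLS :: "(real^'p^'p \<Rightarrow> real) \<Rightarrow> real \<Rightarrow> real \<Rightarrow> real^'p^'p \<Rightarrow> real^'n^'p \<Rightarrow> real^'n^'p" where
  "RLS alpha a b S X =
     (let W = Wmat S X; V = Vmat (alpha W) W
      in X - (a *\<^sub>R V + (b / trace W) *\<^sub>R mat 1) ** (X - Xbar X))"

definition loss :: "real^'p^'p \<Rightarrow> real^'n^'p \<Rightarrow> real^'n^'p \<Rightarrow> real" where
  "loss S Th Est = (1 / (real CARD('n) * real CARD('p))) *
      trace (transpose (Est - Th) ** matrix_inv S ** (Est - Th))"

definition risk :: "real^'p^'p \<Rightarrow> real^'n^'p \<Rightarrow> (real^'n^'p \<Rightarrow> real^'n^'p) \<Rightarrow> real" where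
  "risk S Th est = (\<integral>X. loss S Th (est X) \<partial>(matnormal Th S))"

definition Delta_hat :: "(real^'p^'p \<Rightarrow> real) \<Rightarrow> real \<Rightarrow> real \<Rightarrow> real \<Rightarrow> real^'p^'p \<Rightarrow> real^'n^'p \<Rightarrow> real" where
  "Delta_hat alpha c0 a b S X =
     (let W = Wmat S X; al = alpha W; V = Vmat al W; n = real CARD('n); p = real CARD('p)
      in trace (V ** V ** W) * a^2 + 2 * (trace (V ** W) / trace W) * a * b + b^2 / trace W
         - 2 * (n - p - 1) * trace V * a - 2 * ((n - 1) * p * b) / trace W
         - 2 * al * (trace V)^2 * a + 2 * (2 * c0 + 1) * trace (V ** V ** W) * a
         + 4 * b / trace W)"

end

theory Submission
  imports Defs "HOL-Probability.Distributions"
begin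

text \<open>
  Write \<open>P\<close> for the inverse of \<open>Sigma\<close>, \<open>Y\<close> for the centred matrix, \<open>q Z = tr (Z\<^sup>T P Z)\<close>,
  \<open>w = q Y = tr W\<close> and \<open>g = a V Y + (b / w) Y\<close>, so that the estimator is \<open>X - g\<close>. A direct
  computation shows that the risk estimator equals \<open>q g - 2 div g\<close> off the null set \<open>w = 0\<close>, so the
  theorem is Stein's identity for the field \<open>g\<close>, which is singular at \<open>w = 0\<close>. We regularize
  \<open>1 / w\<close> to \<open>1 / (w + e)\<close> and let \<open>e\<close> tend to 0 by dominated convergence, which works whenever
  \<open>1 / w\<close> is integrable. If \<open>m = p (n - 1) \<ge> 3\<close>, this follows from Stein's identity for
  \<open>Y / (w + e)\<close>, whose divergence is at least \<open>(m - 2) / (w + e)\<close> (a Hardy inequality). If \<open>1 / w\<close> is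
  not integrable, then \<open>m \<le> 2\<close>, hence \<open>p = 1\<close> or \<open>n = 2\<close> and \<open>W Y = w Y\<close>; in that case integrability of the
  loss forces the coefficient of the singular part of \<open>g\<close> to vanish.
\<close>

subsection \<open>Stein's identity on a Euclidean space\<close>

text \<open>The strength of the singularity shapes the proof. Near \<open>w = 0\<close> the field
  \<open>g\<close> is at most of order \<open>1 / |Y|\<close>, so \<open>q g\<close> and
  \<open>div g\<close> are at most of order \<open>1 / w\<close>; the centred space has dimension
  \<open>m\<close>, and \<open>1 / w\<close> is locally integrable exactly for
  \<open>m \<ge> 3\<close>. For \<open>m = 2\<close> the danger is real: \<open>div (Y / w)\<close>
  vanishes off \<open>w = 0\<close>, yet as a distribution it has mass on that set, which the
  pointwise formula cannot see. The loss detects this, because it controls \<open>q g\<close> once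
  the cross term is absorbed by Young's inequality. For the constant ridge only
  \<open>b Y / w\<close> is singular, so \<open>b\<close> itself must vanish. For the ridge
  \<open>c * tr W\<close> both parts of \<open>g\<close> have the same order; when
  \<open>W Y = w Y\<close> they are proportional, and the coefficient that must vanish is
  \<open>a / (1 + c) + b\<close>. The null set \<open>w = 0\<close> needs care because division by
  zero yields 0 there and the inverse of a singular matrix is unspecified.\<close>

lemma translate_borel_integral:
  fixes F :: "'a::euclidean_space \<Rightarrow> real"
  assumes "F \<in> borel_measurable borel"
  shows "integrable lborel (\<lambda>x. F (x + c)) \<longleftrightarrow> integrable lborel F"
    and "(\<integral>x. F (x + c) \<partial>lborel) = (\<integral>x. F x \<partial>lborel)"
proof -
  have "integrable (distr lborel borel ((+) c)) F \<longleftrightarrow> integrable lborel (\<lambda>x. F (c + x))"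
    by (rule integrable_distr_eq) (use assms in auto)
  then show "integrable lborel (\<lambda>x. F (x + c)) \<longleftrightarrow> integrable lborel F"
    by (simp add: lborel_distr_plus add.commute)
  have "integral\<^sup>L (distr lborel borel ((+) c)) F = (\<integral>x. F (c + x) \<partial>lborel)"
    by (rule integral_distr) (use assms in auto)
  then show "(\<integral>x. F (x + c) \<partial>lborel) = (\<integral>x. F x \<partial>lborel)"
    by (simp add: lborel_distr_plus add.commute)
qed

text \<open>Integrating \<open>G (x + e) - G x\<close> over all \<open>x\<close> gives 0 by translation invariance; by Fubini the
  fundamental theorem of calculus turns it into the integral of \<open>G'\<close>.\<close>

lemma integral_directional_derivative_eq_0:
  fixes G G' :: "'a::euclidean_space \<Rightarrow> real"
  assumes der: "\<And>x. ((\<lambda>t. G (x + t *\<^sub>R e)) has_real_derivative G' x) (at 0)"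
    and G: "integrable lborel G" and G': "integrable lborel G'"
  shows "(\<integral>x. G' x \<partial>lborel) = 0"
proof -
  have [measurable]: "G \<in> borel_measurable borel" "G' \<in> borel_measurable borel"
    using G G' by auto
  let ?H = "\<lambda>(t::real, x). indicator {0..1} t * G' (x + t *\<^sub>R e)"
  have tr: "integrable lborel (\<lambda>x. G' (x + c))" "(\<integral>x. \<bar>G' (x + c)\<bar> \<partial>lborel) = (\<integral>x. \<bar>G' x\<bar> \<partial>lborel)"
    "(\<integral>x. G' (x + c) \<partial>lborel) = (\<integral>x. G' x \<partial>lborel)" for c
    using translate_borel_integral[of G' c] translate_borel_integral[of "\<lambda>x. \<bar>G' x\<bar>" c] G' by auto
  \<comment> \<open>By translation invariance the inner integral of the absolute value is the same
    for every \<open>t\<close>, so the double integral is that constant times the length of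
    [0, 1].\<close>
  have H: "integrable (lborel \<Otimes>\<^sub>M lborel) ?H"
  proof (rule lborel_pair.Fubini_integrable)
    show "?H \<in> borel_measurable (lborel \<Otimes>\<^sub>M lborel)"
      by measurable
    have "(\<lambda>t. \<integral>x. norm (?H (t, x)) \<partial>lborel) = (\<lambda>t. indicator {0..1} t *\<^sub>R (\<integral>x. \<bar>G' x\<bar> \<partial>lborel))"
      by (auto simp: fun_eq_iff abs_mult tr split: split_indicator)
    then show "integrable lborel (\<lambda>t. \<integral>x. norm (?H (t, x)) \<partial>lborel)"
      by simp
    show "AE t in lborel. integrable lborel (\<lambda>x. ?H (t, x))"
      by (auto simp: tr)
  qed
  have "(\<integral>t. (\<integral>x. ?H (t, x) \<partial>lborel) \<partial>lborel) = (\<integral>t. indicator {0..1::real} t *\<^sub>R (\<integral>x. G' x \<partial>lborel) \<partial>lborel)"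
    by (simp add: tr)
  also have "\<dots> = (\<integral>x. G' x \<partial>lborel)"
    by simp
  finally have 1: "(\<integral>t. (\<integral>x. ?H (t, x) \<partial>lborel) \<partial>lborel) = (\<integral>x. G' x \<partial>lborel)" .
  have der': "((\<lambda>t. G (x + t *\<^sub>R e)) has_real_derivative G' (x + t *\<^sub>R e)) (at t)" for x t
  proof -
    have "((\<lambda>s. G (x + t *\<^sub>R e + (s - t) *\<^sub>R e)) has_real_derivative G' (x + t *\<^sub>R e)) (at t)"
      using DERIV_shift[of "\<lambda>s. G (x + t *\<^sub>R e + (s - t) *\<^sub>R e)" "G' (x + t *\<^sub>R e)" 0 t]
        der[of "x + t *\<^sub>R e"] by (simp add: add.commute)
    then show ?thesis
      by (simp add: algebra_simps)
  qed
  have "AE x in lborel. integrable lborel (\<lambda>t. indicator {0..1} t * G' (x + t *\<^sub>R e))"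
    using lborel_pair.AE_integrable_snd[OF H] by simp
  then have "AE x in lborel. (\<integral>t. ?H (t, x) \<partial>lborel) = G (x + e) - G x"
    unfolding prod.case
  proof eventually_elim
    fix x assume *: "integrable lborel (\<lambda>t. indicator {0..1} t * G' (x + t *\<^sub>R e))"
    have "set_integrable lborel {0..1} (\<lambda>t. G' (x + t *\<^sub>R e))"
      using * by (simp add: set_integrable_def)
    then have "((\<lambda>t. G' (x + t *\<^sub>R e)) has_integral (\<integral>t\<in>{0..1}. G' (x + t *\<^sub>R e) \<partial>lborel)) {0..1}"
      by (metis set_borel_integral_eq_integral integrable_integral)
    \<comment> \<open>The gauge integral of a derivative is the difference of the endpoint values;
      Lebesgue integrability along almost every line, supplied by Fubini, identifies the two
      integrals.\<close>
    moreover have "((\<lambda>t. G' (x + t *\<^sub>R e)) has_integral (G (x + 1 *\<^sub>R e) - G (x + 0 *\<^sub>R e))) {0..1}"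
      by (rule fundamental_theorem_of_calculus)
        (auto intro: has_field_derivative_at_within der'
              simp flip: has_real_derivative_iff_has_vector_derivative)
    ultimately show "(\<integral>t. indicator {0..1} t * G' (x + t *\<^sub>R e) \<partial>lborel) = G (x + e) - G x"
      by (auto dest: has_integral_unique simp: set_lebesgue_integral_def)
  qed
  then have "(\<integral>x. (\<integral>t. ?H (t, x) \<partial>lborel) \<partial>lborel) = (\<integral>x. G (x + e) - G x \<partial>lborel)"
    using H by (intro integral_cong_AE) (auto intro: lborel_pair.integrable_snd dest: borel_measurable_integrable)
  also have "\<dots> = 0"
    using translate_borel_integral[of G e] G by simp
  finally show ?thesis
    using 1 lborel_pair.Fubini_integral[of "\<lambda>t x. ?H (t, x)"] H by simp
qed

text \<open>The function factors over the coordinates, and each factor is a multiple of the normal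
  density with variance \<open>1 / (2 * \<mu>)\<close>.\<close>

lemma integrable_exp_norm_sq:
  assumes "\<mu> > 0"
  shows "integrable lborel (\<lambda>x::'a::euclidean_space. exp (- \<mu> * (norm x)\<^sup>2))"
proof (rule integrableI_bounded)
  define s where "s = 1 / sqrt (2 * \<mu>)"
  have s: "s > 0" "2 * s\<^sup>2 = 1 / \<mu>"
    using assms by (auto simp: s_def power_divide)
  have "\<mu> = 1 / (2 * s\<^sup>2)"
    using s assms by (simp add: s(2))
  then have "(\<lambda>x::real. exp (- \<mu> * x\<^sup>2)) = (\<lambda>x. sqrt (2 * pi * s\<^sup>2) * normal_density 0 s x)"
    using s by (simp add: normal_density_def mult.commute)
  then have i: "integrable lborel (\<lambda>x::real. exp (- \<mu> * x\<^sup>2))"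
    using s by simp
  have "(\<integral>\<^sup>+ x. ennreal (norm (exp (- \<mu> * (norm x)\<^sup>2))) \<partial>(lborel::'a measure)) =
        (\<integral>\<^sup>+ x. (\<Prod>b\<in>Basis. ennreal (exp (- \<mu> * (x \<bullet> b)\<^sup>2))) \<partial>(lborel::'a measure))"
  proof (intro nn_integral_cong)
    fix x :: 'a
    have n: "(norm x)\<^sup>2 = (\<Sum>b\<in>Basis. (x \<bullet> b)\<^sup>2)"
      unfolding power2_norm_eq_inner by (subst euclidean_inner) (simp add: power2_eq_square)
    have "exp (- \<mu> * (norm x)\<^sup>2) = (\<Prod>b\<in>Basis. exp (- \<mu> * (x \<bullet> b)\<^sup>2))"
      unfolding n sum_distrib_left by (rule exp_sum) simp
    then show "ennreal (norm (exp (- \<mu> * (norm x)\<^sup>2))) = (\<Prod>b\<in>Basis. ennreal (exp (- \<mu> * (x \<bullet> b)\<^sup>2)))"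
      by (simp add: prod_ennreal prod_nonneg)
  qed
  also have "\<dots> = (\<Prod>b\<in>(Basis::'a set). (\<integral>\<^sup>+ x. ennreal (exp (- \<mu> * x\<^sup>2)) \<partial>lborel))"
    by (rule nn_integral_lborel_prod) auto
  also have "\<dots> < \<infinity>"
    using i by (simp add: less_top[symmetric] power_eq_top_ennreal integrable_iff_bounded)
  finally show "(\<integral>\<^sup>+ x. ennreal (norm (exp (- \<mu> * (norm x)\<^sup>2))) \<partial>(lborel::'a measure)) < \<infinity>" .
qed simp

text \<open>A Gaussian density with mean \<open>\<theta>\<close> and precision operator
  \<open>A\<close>, without its normalizing constant: Stein's identity is linear in the density, so
  the constant can be restored at the end.\<close>

definition gker :: "('a::euclidean_space \<Rightarrow> 'a) \<Rightarrow> 'a \<Rightarrow> 'a \<Rightarrow> real" where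
  "gker A \<theta> x = exp (- (1/2) * ((x - \<theta>) \<bullet> A (x - \<theta>)))"

lemma gker_pos [simp]: "gker A \<theta> x > 0" "gker A \<theta> x \<ge> 0" "gker A \<theta> x \<noteq> 0"
  by (auto simp: gker_def)

locale gaussian =
  fixes A :: "'a::euclidean_space \<Rightarrow> 'a" and la :: real and \<theta> :: 'a
  assumes linA: "linear A"
    and symA: "x \<bullet> A y = A x \<bullet> y"
    and lam_pos: "la > 0"
    and coercive: "la * (norm x)\<^sup>2 \<le> x \<bullet> A x"
begin

abbreviation "f \<equiv> gker A \<theta>"

lemma bounded_linear_A: "bounded_linear A"
  using linA by (simp add: linear_conv_bounded_linear)

lemma cont_A [continuous_intros]: "continuous_on S h \<Longrightarrow> continuous_on S (\<lambda>x. A (h x))"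
  using bounded_linear_A by (rule bounded_linear.continuous_on)

lemma cont_f [continuous_intros]: "continuous_on S h \<Longrightarrow> continuous_on S (\<lambda>x. f (h x))"
  unfolding gker_def by (intro continuous_intros)

lemma meas_f [measurable]: "f \<in> borel_measurable borel"
  by (intro borel_measurable_continuous_onI continuous_intros)

lemma meas_A [measurable]: "A \<in> borel_measurable borel"
  by (intro borel_measurable_continuous_onI continuous_intros)

text \<open>Coercivity gives the decay \<open>exp (- (la/2) * r)\<close> with \<open>r\<close> the
  squared distance to \<open>\<theta>\<close>. Half of this exponent dominates the polynomial
  factor, which is where \<open>8 / la\<close> comes from, and the other half stays
  integrable.\<close>

lemma integrable_poly: "integrable lborel (\<lambda>x. f x * (1 + (norm x)\<^sup>2))"
proof -
  define B where "B = 2 + 2 * (norm \<theta>)\<^sup>2"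
  have "integrable lborel (\<lambda>x::'a. exp (- (la/4) * (norm x)\<^sup>2))"
    using lam_pos by (intro integrable_exp_norm_sq) auto
  then have "integrable lborel (\<lambda>x. exp (- (la/4) * (norm (x + (- \<theta>)))\<^sup>2))"
    by (subst translate_borel_integral(1)[of "\<lambda>x. exp (- (la/4) * (norm x)\<^sup>2)"]) auto
  then have i: "integrable lborel (\<lambda>x. (B + 8 / la) * exp (- (la/4) * (norm (x - \<theta>))\<^sup>2))"
    by simp
  show ?thesis
  proof (rule Bochner_Integration.integrable_bound[OF i])
    show "AE x in lborel. norm (f x * (1 + (norm x)\<^sup>2))
        \<le> norm ((B + 8 / la) * exp (- (la/4) * (norm (x - \<theta>))\<^sup>2))"
    proof (rule AE_I2)
      fix x
      define r where "r = (norm (x - \<theta>))\<^sup>2"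
      have r: "r \<ge> 0" by (simp add: r_def)
      have "norm x \<le> norm (x - \<theta>) + norm \<theta>"
        using norm_triangle_ineq[of "x - \<theta>" \<theta>] by simp
      then have "(norm x)\<^sup>2 \<le> (norm (x - \<theta>) + norm \<theta>)\<^sup>2"
        by (intro power_mono) auto
      also have "\<dots> \<le> 2 * r + 2 * (norm \<theta>)\<^sup>2"
        using zero_le_power2[of "norm (x - \<theta>) - norm \<theta>"] unfolding r_def
        by (simp add: power2_eq_square algebra_simps)
      finally have 1: "1 + (norm x)\<^sup>2 \<le> B + 2 * r"
        by (simp add: B_def)
      have 2: "1 + la/4 * r \<le> exp (la/4 * r)"
        by (rule exp_ge_add_one_self)
      have B: "B \<ge> 2" by (simp add: B_def)
      have e1: "exp (la/4 * r) \<ge> 1" using r lam_pos by simp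
      have "2 * r \<le> (8/la) * exp (la/4 * r)"
        using 2 lam_pos by (simp add: field_simps)
      moreover have "B \<le> B * exp (la/4 * r)"
        using e1 B by simp
      ultimately have 3: "1 + (norm x)\<^sup>2 \<le> (B + 8/la) * exp (la/4 * r)"
        using 1 by (simp add: distrib_right)
      have 4: "f x \<le> exp (- (la/2) * r)"
        using coercive[of "x - \<theta>"] by (simp add: gker_def r_def)
      have "f x * (1 + (norm x)\<^sup>2) \<le> exp (- (la/2) * r) * ((B + 8/la) * exp (la/4 * r))"
        using 3 4 by (intro mult_mono) auto
      also have "\<dots> = (B + 8/la) * exp (- (la/4) * r)"
        by (simp add: exp_add[symmetric] algebra_simps)
      finally show "norm (f x * (1 + (norm x)\<^sup>2))
        \<le> norm ((B + 8 / la) * exp (- (la/4) * (norm (x - \<theta>))\<^sup>2))"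
        using B lam_pos by (simp add: r_def abs_mult)
    qed
  qed simp
qed

lemma integrable_bounded_poly:
  assumes [measurable]: "F \<in> borel_measurable borel"
    and "\<And>x. \<bar>F x\<bar> \<le> K * (1 + (norm x)\<^sup>2)"
  shows "integrable lborel (\<lambda>x. f x * F x)"
proof (rule Bochner_Integration.integrable_bound)
  show "integrable lborel (\<lambda>x. K * (f x * (1 + (norm x)\<^sup>2)))"
    using integrable_poly by simp
  show "AE x in lborel. norm (f x * F x) \<le> norm (K * (f x * (1 + (norm x)\<^sup>2)))"
  proof (rule AE_I2)
    fix x
    have "f x * \<bar>F x\<bar> \<le> f x * (K * (1 + (norm x)\<^sup>2))"
      by (intro mult_left_mono assms(2)) simp
    also have "\<dots> \<le> \<bar>K * (f x * (1 + (norm x)\<^sup>2))\<bar>"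
      by (simp add: mult.left_commute)
    finally show "norm (f x * F x) \<le> norm (K * (f x * (1 + (norm x)\<^sup>2)))"
      by (simp add: abs_mult)
  qed
qed simp

lemma f_deriv: "(f has_derivative (\<lambda>h. - f x * (h \<bullet> A (x - \<theta>)))) (at x)"
proof -
  have d: "((\<lambda>x. x - \<theta>) has_derivative (\<lambda>h. h)) (at x)"
    by (auto intro!: derivative_eq_intros)
  have "((\<lambda>x. (x - \<theta>) \<bullet> A (x - \<theta>)) has_derivative (\<lambda>h. (x - \<theta>) \<bullet> A h + h \<bullet> A (x - \<theta>))) (at x)"
    by (rule has_derivative_inner[OF d bounded_linear.has_derivative[OF bounded_linear_A d]])
  then have "((\<lambda>x. (x - \<theta>) \<bullet> A (x - \<theta>)) has_derivative (\<lambda>h. 2 * (h \<bullet> A (x - \<theta>)))) (at x)"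
    by (rule has_derivative_eq_rhs) (simp add: fun_eq_iff, metis inner_commute symA)
  then have "((\<lambda>x. - (1/2) * ((x - \<theta>) \<bullet> A (x - \<theta>))) has_derivative
      (\<lambda>h. - (1/2) * (2 * (h \<bullet> A (x - \<theta>))))) (at x)"
    by (rule has_derivative_mult_right)
  from has_derivative_exp[OF this] show ?thesis
    unfolding gker_def by (rule has_derivative_eq_rhs) (simp add: fun_eq_iff)
qed

text \<open>For each basis vector \<open>b\<close>, the derivative of
  \<open>f * (b \<bullet> g)\<close> along \<open>b\<close> integrates to 0; the product rule splits
  it into a term of the divergence and a term of the pairing with \<open>A (x - \<theta>)\<close>.
  The two growth conditions are those satisfied by the regularized fields and keep each term below a
  multiple of the integrable weight \<open>f x * (1 + (norm x)^2)\<close>.\<close>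

theorem stein:
  fixes g :: "'a \<Rightarrow> 'a"
  assumes g': "\<And>x. (g has_derivative g' x) (at x)"
    and bg: "\<And>x. norm (g x) \<le> K * (1 + norm x)"
    and bg': "\<And>x b. b \<in> Basis \<Longrightarrow> norm (g' x b) \<le> K * (1 + (norm x)\<^sup>2)"
  shows "integrable lborel (\<lambda>x. f x * (g x \<bullet> A (x - \<theta>)))"
    and "integrable lborel (\<lambda>x. f x * (\<Sum>b\<in>Basis. b \<bullet> g' x b))"
    and "(\<integral>x. f x * (g x \<bullet> A (x - \<theta>)) \<partial>lborel) = (\<integral>x. f x * (\<Sum>b\<in>Basis. b \<bullet> g' x b) \<partial>lborel)"
proof -
  have "continuous_on UNIV g"
    using g' by (intro continuous_at_imp_continuous_on ballI) (rule has_derivative_continuous)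
  then have mg [measurable]: "g \<in> borel_measurable borel"
    by (rule borel_measurable_continuous_onI)
  have lin: "linear (g' x)" for x
    using g' has_derivative_linear by blast
  \<comment> \<open>The derivative is known only pointwise; its measurability comes from writing it
    as a limit of difference quotients of \<open>g\<close> with steps
    \<open>1 / (n + 1)\<close>.\<close>
  have mg' [measurable]: "(\<lambda>x. g' x b) \<in> borel_measurable borel" for b
  proof (rule borel_measurable_LIMSEQ_metric)
    fix x
    show "(\<lambda>n. real (Suc n) *\<^sub>R (g (x + (1 / real (Suc n)) *\<^sub>R b) - g x)) \<longlonglongrightarrow> g' x b"
    proof -
      have "((\<lambda>t. g (x + t *\<^sub>R b)) has_derivative (\<lambda>t. g' x (t *\<^sub>R b))) (at 0)"
        by (rule has_derivative_compose[where g = g, of "\<lambda>t. x + t *\<^sub>R b"])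
           (auto intro!: derivative_eq_intros g')
      then have "((\<lambda>t. norm (g (x + t *\<^sub>R b) - g x - t *\<^sub>R g' x b) / norm t) \<longlongrightarrow> 0) (at 0)"
        by (simp add: has_derivative_at linear_scale[OF lin])
      then have "((\<lambda>t. norm ((1 / t) *\<^sub>R (g (x + t *\<^sub>R b) - g x) - g' x b)) \<longlongrightarrow> 0) (at 0)"
      proof (rule Lim_transform_eventually)
        have "norm (v - t *\<^sub>R w) / norm t = norm ((1 / t) *\<^sub>R v - w)" if "t \<noteq> 0" for t and v w :: 'a
          using that norm_scaleR[of "1 / t" "v - t *\<^sub>R w"] by (simp add: scaleR_diff_right)
        then show "\<forall>\<^sub>F t in at 0. norm (g (x + t *\<^sub>R b) - g x - t *\<^sub>R g' x b) / norm t
            = norm ((1 / t) *\<^sub>R (g (x + t *\<^sub>R b) - g x) - g' x b)"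
          by (auto simp: eventually_at_filter)
      qed
      then have "((\<lambda>t. (1 / t) *\<^sub>R (g (x + t *\<^sub>R b) - g x)) \<longlongrightarrow> g' x b) (at 0)"
        by (simp add: tendsto_norm_zero_iff LIM_zero_cancel)
      moreover have "filterlim (\<lambda>n. 1 / real (Suc n)) (at 0) sequentially"
        by (rule filterlim_atI[OF lim_1_over_n[THEN LIMSEQ_Suc]]) auto
      ultimately show ?thesis
        using filterlim_compose[of "\<lambda>t. (1 / t) *\<^sub>R (g (x + t *\<^sub>R b) - g x)" "nhds (g' x b)" "at 0"
            "\<lambda>n. 1 / real (Suc n)" sequentially] by simp
    qed
  qed simp
  have Kpos: "K \<ge> 0"
    using order_trans[OF norm_ge_zero bg[of 0]] by simp
  obtain L where L: "L > 0" "\<And>x. norm (A x) \<le> norm x * L"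
    using bounded_linear.pos_bounded[OF bounded_linear_A] by blast
  have bd: "norm (g x) * norm (A (x - \<theta>)) \<le> (K * L * (4 + (norm \<theta>)\<^sup>2)) * (1 + (norm x)\<^sup>2)" for x
  proof -
    have sq: "(1 + norm x) * (norm x + norm \<theta>) \<le> (4 + (norm \<theta>)\<^sup>2) * (1 + (norm x)\<^sup>2)"
    proof -
      let ?a = "norm x" and ?b = "norm \<theta>"
      have "2 * ?a \<le> 1 + ?a\<^sup>2" "2 * ?b \<le> 1 + ?b\<^sup>2" "2 * (?a * ?b) \<le> ?a\<^sup>2 + ?b\<^sup>2"
        using zero_le_power2[of "?a - 1"] zero_le_power2[of "?b - 1"] zero_le_power2[of "?a - ?b"]
        by (auto simp: power2_eq_square algebra_simps)
      moreover have "0 \<le> ?b\<^sup>2 * ?a\<^sup>2" "0 \<le> ?a\<^sup>2" by simp_all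
      moreover have "(1 + ?a) * (?a + ?b) = ?a + ?b + ?a\<^sup>2 + ?a * ?b"
        "(4 + ?b\<^sup>2) * (1 + ?a\<^sup>2) = 4 + 4 * ?a\<^sup>2 + ?b\<^sup>2 + ?b\<^sup>2 * ?a\<^sup>2"
        by (simp_all add: algebra_simps power2_eq_square)
      ultimately show ?thesis
        by linarith
    qed
    have "norm (g x) * norm (A (x - \<theta>)) \<le> (K * (1 + norm x)) * ((norm x + norm \<theta>) * L)"
      using L(1) Kpos by (intro mult_mono bg order_trans[OF L(2)] norm_triangle_ineq4 mult_right_mono) auto
    also have "\<dots> = (K * L) * ((1 + norm x) * (norm x + norm \<theta>))"
      by simp
    also have "\<dots> \<le> (K * L) * ((4 + (norm \<theta>)\<^sup>2) * (1 + (norm x)\<^sup>2))"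
      using sq Kpos L by (intro mult_left_mono) auto
    finally show ?thesis by simp
  qed
  have bound: "\<bar>g x \<bullet> A (x - \<theta>)\<bar> \<le> (K * L * (4 + (norm \<theta>)\<^sup>2)) * (1 + (norm x)\<^sup>2)" for x
    by (rule order_trans[OF Cauchy_Schwarz_ineq2 bd])
  show i1: "integrable lborel (\<lambda>x. f x * (g x \<bullet> A (x - \<theta>)))"
    by (rule integrable_bounded_poly[OF _ bound]) simp
  have comp: "integrable lborel (\<lambda>x. f x * (b \<bullet> g' x b))"
             "integrable lborel (\<lambda>x. f x * ((b \<bullet> g x) * (b \<bullet> A (x - \<theta>))))"
             "(\<integral>x. f x * (b \<bullet> g' x b) - f x * ((b \<bullet> g x) * (b \<bullet> A (x - \<theta>))) \<partial>lborel) = 0"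
    if b: "b \<in> Basis" for b
  proof -
    have "\<bar>b \<bullet> g x\<bar> \<le> 2 * K * (1 + (norm x)\<^sup>2)" for x
    proof -
      have "\<bar>b \<bullet> g x\<bar> \<le> K * (1 + norm x)"
        using Basis_le_norm[OF b, of "g x"] bg[of x] by (simp add: inner_commute[of b])
      also have "\<dots> \<le> K * (2 * (1 + (norm x)\<^sup>2))"
      proof (rule mult_left_mono[OF _ Kpos])
        have "2 * norm x \<le> (norm x)\<^sup>2 + 1"
          using sum_squares_bound[of "norm x" 1] by simp
        moreover have "0 \<le> (norm x)\<^sup>2"
          by simp
        ultimately show "1 + norm x \<le> 2 * (1 + (norm x)\<^sup>2)"
          unfolding distrib_left using norm_ge_zero[of x] by linarith
      qed
      finally show ?thesis by (simp add: algebra_simps)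
    qed
    then have i0: "integrable lborel (\<lambda>x. f x * (b \<bullet> g x))"
      by (intro integrable_bounded_poly[where K = "2 * K"]) auto
    have "\<bar>b \<bullet> g' x b\<bar> \<le> norm (g' x b)" for x
      using Basis_le_norm[OF b, of "g' x b"] by (simp add: inner_commute)
    then show i1: "integrable lborel (\<lambda>x. f x * (b \<bullet> g' x b))"
      by (intro integrable_bounded_poly[where K = K]) (auto intro: order_trans[OF _ bg'[OF b]])
    have "\<bar>(b \<bullet> g x) * (b \<bullet> A (x - \<theta>))\<bar> \<le> (K * L * (4 + (norm \<theta>)\<^sup>2)) * (1 + (norm x)\<^sup>2)" for x
    proof -
      have "\<bar>(b \<bullet> g x) * (b \<bullet> A (x - \<theta>))\<bar> \<le> norm (g x) * norm (A (x - \<theta>))"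
        unfolding abs_mult using Basis_le_norm[OF b] by (intro mult_mono) (auto simp: inner_commute[of b])
      with bd[of x] show ?thesis by linarith
    qed
    then show i2: "integrable lborel (\<lambda>x. f x * ((b \<bullet> g x) * (b \<bullet> A (x - \<theta>))))"
      by (intro integrable_bounded_poly) auto
    show "(\<integral>x. f x * (b \<bullet> g' x b) - f x * ((b \<bullet> g x) * (b \<bullet> A (x - \<theta>))) \<partial>lborel) = 0"
    proof (rule integral_directional_derivative_eq_0[where e = b])
      show "integrable lborel (\<lambda>x. f x * (b \<bullet> g x))" by (rule i0)
      show "integrable lborel (\<lambda>x. f x * (b \<bullet> g' x b) - f x * ((b \<bullet> g x) * (b \<bullet> A (x - \<theta>))))"
        using i1 i2 by simp
      fix x
      have "((\<lambda>x. f x * (b \<bullet> g x)) has_derivative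
          (\<lambda>h. f x * (b \<bullet> g' x h) + (- f x * (h \<bullet> A (x - \<theta>))) * (b \<bullet> g x))) (at x)"
        by (auto intro!: derivative_eq_intros f_deriv g')
      then have "((\<lambda>t. f (x + t *\<^sub>R b) * (b \<bullet> g (x + t *\<^sub>R b))) has_derivative
          (\<lambda>t. f x * (b \<bullet> g' x (t *\<^sub>R b)) + (- f x * ((t *\<^sub>R b) \<bullet> A (x - \<theta>))) * (b \<bullet> g x))) (at 0)"
        by (intro has_derivative_compose[where g = "\<lambda>x. f x * (b \<bullet> g x)" and f = "\<lambda>t. x + t *\<^sub>R b"])
           (auto intro!: derivative_eq_intros)
      then show "((\<lambda>t. f (x + t *\<^sub>R b) * (b \<bullet> g (x + t *\<^sub>R b))) has_real_derivative
          f x * (b \<bullet> g' x b) - f x * ((b \<bullet> g x) * (b \<bullet> A (x - \<theta>)))) (at 0)"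
        unfolding has_field_derivative_def
        by (rule has_derivative_eq_rhs) (simp add: fun_eq_iff linear_scale[OF lin] algebra_simps)
    qed
  qed
  show i2: "integrable lborel (\<lambda>x. f x * (\<Sum>b\<in>Basis. b \<bullet> g' x b))"
    unfolding sum_distrib_left by (intro Bochner_Integration.integrable_sum comp)
  have "(\<integral>x. f x * (\<Sum>b\<in>Basis. b \<bullet> g' x b) \<partial>lborel) - (\<integral>x. f x * (g x \<bullet> A (x - \<theta>)) \<partial>lborel)
      = (\<integral>x. (\<Sum>b\<in>Basis. f x * (b \<bullet> g' x b) - f x * ((b \<bullet> g x) * (b \<bullet> A (x - \<theta>)))) \<partial>lborel)"
    using i1 i2
    by (subst Bochner_Integration.integral_diff[symmetric])
       (auto simp: sum_subtractf sum_distrib_left euclidean_inner[of "g _"] inner_commute intro!: Bochner_Integration.integral_cong)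
  also have "\<dots> = 0"
    using comp by (subst Bochner_Integration.integral_sum) auto
  finally show "(\<integral>x. f x * (g x \<bullet> A (x - \<theta>)) \<partial>lborel) = (\<integral>x. f x * (\<Sum>b\<in>Basis. b \<bullet> g' x b) \<partial>lborel)"
    by simp
qed

end

subsection \<open>Matrix algebra\<close>

lemma norm_sq_vec: "(norm (x :: ('a::real_inner)^'n))\<^sup>2 = (\<Sum>i\<in>UNIV. (norm (x $ i))\<^sup>2)"
  unfolding power2_norm_eq_inner inner_vec_def ..

lemma norm_sq_mat: "(norm (A :: real^'n^'m))\<^sup>2 = (\<Sum>i\<in>UNIV. \<Sum>j\<in>UNIV. (A $ i $ j)\<^sup>2)"
  by (simp add: norm_sq_vec)

lemma norm_sq_columns: "(norm (A :: real^'n^'m))\<^sup>2 = (\<Sum>j\<in>UNIV. (norm (column j A))\<^sup>2)"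
  unfolding norm_sq_mat by (subst sum.swap) (simp add: norm_sq_vec column_def)

text \<open>The norm of nested vectors is the Frobenius norm, and every entry of the product pairs a
  row with a column, so Cauchy-Schwarz applies entrywise.\<close>

lemma norm_matrix_mult_le:
  fixes A :: "real^'n^'m" and B :: "real^'k^'n"
  shows "norm (A ** B) \<le> norm A * norm B"
proof -
  have entry: "(A ** B) $ i $ j = (A $ i) \<bullet> column j B" for i j
    by (simp add: matrix_matrix_mult_def inner_vec_def column_def)
  have "(norm (A ** B))\<^sup>2 = (\<Sum>i\<in>UNIV. \<Sum>j\<in>UNIV. ((A $ i) \<bullet> column j B)\<^sup>2)"
    unfolding norm_sq_mat entry ..
  also have "\<dots> \<le> (\<Sum>i\<in>UNIV. \<Sum>j\<in>UNIV. (norm (A $ i))\<^sup>2 * (norm (column j B))\<^sup>2)"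
    using Cauchy_Schwarz_ineq by (intro sum_mono) (auto simp: power2_norm_eq_inner)
  also have "\<dots> = (\<Sum>i\<in>UNIV. (norm (A $ i))\<^sup>2) * (\<Sum>j\<in>UNIV. (norm (column j B))\<^sup>2)"
    by (simp add: sum_product)
  also have "\<dots> = (norm A * norm B)\<^sup>2"
    by (simp add: power_mult_distrib norm_sq_columns[of B] norm_sq_vec[of A])
  finally show ?thesis
    by (rule power2_le_imp_le) simp
qed

lemma bounded_bilinear_matrix_mult:
  "bounded_bilinear ((**) :: real^'n^'m \<Rightarrow> real^'k^'n \<Rightarrow> real^'k^'m)"
proof
  show "\<exists>K. \<forall>(a :: real^'n^'m) (b :: real^'k^'n). norm (a ** b) \<le> norm a * norm b * K"
    using norm_matrix_mult_le by (intro exI[of _ 1]) auto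
qed (simp_all add: matrix_matrix_mult_def vec_eq_iff sum.distrib sum_distrib_left algebra_simps)

interpretation mm: bounded_bilinear "(**) :: real^'n^'m \<Rightarrow> real^'k^'n \<Rightarrow> real^'k^'m"
  by (rule bounded_bilinear_matrix_mult)

lemma norm_transpose: "norm (transpose (A :: real^'n^'m)) = norm A"
proof (rule power2_eq_imp_eq)
  show "(norm (transpose A))\<^sup>2 = (norm A)\<^sup>2"
    unfolding norm_sq_mat transpose_def by (subst sum.swap) simp
qed simp_all

lemma bounded_linear_transpose: "bounded_linear (transpose :: real^'n^'m \<Rightarrow> real^'m^'n)"
proof (rule bounded_linear_intro[where K = 1])
  show "norm (transpose A) \<le> norm A * 1" for A :: "real^'n^'m"
    by (simp add: norm_transpose)
qed (simp_all add: transpose_def vec_eq_iff)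

lemma inner_mat_trace: "(A :: real^'n^'m) \<bullet> B = trace (transpose A ** B)"
  unfolding inner_vec_def trace_def transpose_def matrix_matrix_mult_def
  by (simp add: sum.swap[of _ "UNIV::'m set"])

lemma inner_matrix_mult_left: "((M :: real^'m^'k) ** A) \<bullet> B = (A :: real^'n^'m) \<bullet> (transpose M ** B)"
  by (simp add: inner_mat_trace matrix_transpose_mul matrix_mul_assoc)

lemma inner_matrix_mult_right: "((A :: real^'n^'m) ** N) \<bullet> B = A \<bullet> (B ** transpose N)"
proof -
  have "trace (transpose N ** (transpose A ** B)) = trace ((transpose A ** B) ** transpose N)"
    by (rule trace_mul_sym)
  then show ?thesis
    by (simp add: inner_mat_trace matrix_transpose_mul matrix_mul_assoc)
qed

lemma trace_scaleR: "trace (c *\<^sub>R (A :: real^'n^'n)) = c * trace A"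
  by (simp add: trace_def sum_distrib_left)

section \<open>Divergences of linear maps between matrices\<close>

lemma sum_Basis_vec:
  "(\<Sum>b\<in>Basis. F (b :: 'a::euclidean_space^'n)) = (\<Sum>i\<in>UNIV. \<Sum>u\<in>Basis. F (axis i u))"
proof -
  have "inj_on (\<lambda>(i, u). axis i u :: 'a^'n) (UNIV \<times> Basis)"
    by (auto simp: inj_on_def axis_eq_axis)
  moreover have "(Basis :: ('a^'n) set) = (\<lambda>(i, u). axis i u) ` (UNIV \<times> Basis)"
    by (auto simp: Basis_vec_def)
  ultimately have "(\<Sum>b\<in>Basis. F (b :: 'a^'n)) = (\<Sum>(i, u)\<in>UNIV \<times> Basis. F (axis i u))"
    using sum.reindex[of "\<lambda>(i, u). axis i u :: 'a^'n" "UNIV \<times> Basis" F] by (simp add: case_prod_unfold o_def)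
  then show ?thesis
    by (simp add: sum.cartesian_product)
qed

lemma sum_Basis_mat: "(\<Sum>b\<in>Basis. F (b :: real^'n^'m)) = (\<Sum>i\<in>UNIV. \<Sum>j\<in>UNIV. F (axis i (axis j 1)))"
  by (simp add: sum_Basis_vec)

lemma inner_mat_axis: "axis i (axis j 1) \<bullet> (A :: real^'n^'m) = A $ i $ j"
  by (simp add: inner_axis' inner_real_def)

text \<open>The left side is the trace of the linear map \<open>b \<mapsto> M ** b ** N\<close>,
  that is, of a Kronecker product, and such a trace is multiplicative.\<close>

lemma sum_Basis_trace_mult:
  "(\<Sum>b\<in>Basis. (b :: real^'n^'m) \<bullet> (M ** b ** N)) = trace M * trace N"
proof -
  have "(M ** axis i (axis j 1) ** N) $ i $ j = M $ i $ i * N $ j $ j" for i j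
    by (simp add: matrix_matrix_mult_def axis_def if_distrib[of "\<lambda>x. x $ _"] if_distrib[of "(*) _"]
        if_distrib[of "\<lambda>x. x * _"] if_distribR sum.delta cong: if_cong)
  then show ?thesis
    by (simp add: sum_Basis_mat inner_mat_axis trace_def sum_product)
qed

text \<open>At the matrix unit with indices \<open>i\<close>, \<open>j\<close>, the summand is
  \<open>A $ i $ j * B $ i $ j\<close>. This handles the terms in which the increment enters through
  a transpose.\<close>

lemma sum_Basis_transpose_mult:
  "(\<Sum>b\<in>Basis. (b :: real^'n^'m) \<bullet> (A ** transpose b ** B)) = A \<bullet> B"
proof -
  have "(A ** transpose (axis i (axis j 1))) $ i $ k = (if k = i then A $ i $ j else 0)" for i j k
    by (simp add: matrix_matrix_mult_def transpose_def axis_def if_distrib[of "\<lambda>x. x $ _"] if_distrib[of "(*) _"]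
        if_distribR sum.delta cong: if_cong)
  then have "(A ** transpose (axis i (axis j 1)) ** B) $ i $ j = A $ i $ j * B $ i $ j" for i j
    by (simp add: matrix_matrix_mult_def[of _ B] if_distrib[of "\<lambda>x. x * _"] cong: if_cong)
  then show ?thesis
    by (simp add: sum_Basis_mat inner_mat_axis) (simp add: inner_vec_def)
qed

section \<open>The matrix inverse and its derivative\<close>

lemma matrix_inv_mult:
  fixes A :: "real^'n^'n"
  assumes "invertible A"
  shows "A ** matrix_inv A = mat 1" "matrix_inv A ** A = mat 1"
  using someI_ex[OF assms[unfolded invertible_def]] unfolding matrix_inv_def by auto

lemma matrix_inv_unique:
  fixes A B :: "real^'n^'n"
  assumes "B ** A = mat 1"
  shows "matrix_inv A = B"
proof -
  have "invertible A"
    using assms by (auto simp: invertible_left_inverse)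
  then have "B ** (A ** matrix_inv A) = B"
    by (simp add: matrix_inv_mult)
  then show ?thesis
    by (simp add: matrix_mul_assoc assms)
qed

text \<open>The resolvent identity; it bounds the inverses near a given matrix and, inserted into
  itself, yields the second-order remainder of the inverse.\<close>

lemma matrix_inv_resolvent:
  fixes A B :: "real^'n^'n"
  assumes "invertible A" "invertible B"
  shows "matrix_inv B = matrix_inv A - matrix_inv B ** (B - A) ** matrix_inv A"
proof -
  have "matrix_inv B ** (B - A) ** matrix_inv A
      = (matrix_inv B ** B) ** matrix_inv A - matrix_inv B ** (A ** matrix_inv A)"
    by (simp only: mm.diff_right mm.diff_left matrix_mul_assoc)
  then show ?thesis
    using assms by (simp add: matrix_inv_mult)
qed

text \<open>The vector is read as a one-column matrix \<open>Z\<close>, which reduces the bound to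
  the Frobenius estimate.\<close>

lemma norm_matrix_vector_le: "norm ((A :: real^'n^'m) *v x) \<le> norm A * norm x"
proof -
  define Z :: "real^1^'n" where "Z = (\<chi> i j. x $ i)"
  have 1: "norm Z = norm x"
    by (rule power2_eq_imp_eq) (simp_all add: norm_sq_vec Z_def)
  have 2: "norm (A ** Z) = norm (A *v x)"
    by (rule power2_eq_imp_eq)
      (simp_all add: norm_sq_vec Z_def matrix_matrix_mult_def matrix_vector_mult_def)
  show ?thesis
    using norm_matrix_mult_le[of A Z] by (simp add: 1 2)
qed

text \<open>Write \<open>R\<close> for the inverse of \<open>A\<close> and \<open>a\<close> for its
  norm. If \<open>norm H \<le> 1 / (2 * a)\<close>, then \<open>R ** H\<close> has norm at most 1/2,
  so \<open>A + H\<close> is injective with inverse \<open>S\<close> of norm at most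
  \<open>2 * a\<close>. Applying the resolvent identity twice leaves the remainder
  \<open>S ** H ** R ** H ** R\<close>, which is quadratic in \<open>H\<close>.\<close>

lemma has_derivative_matrix_inv:
  fixes A :: "real^'n^'n"
  assumes inv: "invertible A"
  shows "(matrix_inv has_derivative (\<lambda>H. - (matrix_inv A ** H ** matrix_inv A))) (at A)"
proof -
  let ?R = "matrix_inv A"
  define a where "a = norm ?R"
  have "a > 0"
  proof -
    have "?R \<noteq> 0"
    proof
      assume "?R = 0"
      then have "(mat 1 :: real^'n^'n) = 0"
        using matrix_inv_mult(1)[OF inv] by simp
      then show False
        by (metis mat_0 matrix_vector_mul_lid matrix_vector_mult_0 one_index one_neq_zero zero_index)
    qed
    then show ?thesis by (simp add: a_def)
  qed
  have near: "invertible (A + H) \<and> norm (matrix_inv (A + H)) \<le> 2 * a" if H: "norm H \<le> 1 / (2 * a)" for H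
  proof -
    have aH: "a * norm H \<le> 1/2"
      using H \<open>a > 0\<close> by (simp add: field_simps)
    have "x = 0" if "(A + H) *v x = 0" for x
    proof -
      have "?R *v ((A + H) *v x) = x + (?R ** H) *v x"
        by (simp only: matrix_vector_mul_assoc mm.add_right matrix_inv_mult[OF inv] matrix_vector_mult_add_rdistrib
            matrix_vector_mul_lid matrix_vector_right_distrib)
      then have "x = - ((?R ** H) *v x)"
        using that by (simp add: eq_neg_iff_add_eq_0)
      then have "norm x \<le> norm (?R ** H) * norm x"
        by (metis norm_matrix_vector_le norm_minus_cancel)
      also have "\<dots> \<le> (1/2) * norm x"
        using norm_matrix_mult_le[of ?R H] aH by (intro mult_right_mono) (auto simp: a_def)
      finally show ?thesis by simp
    qed
    then have inv': "invertible (A + H)"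
      by (meson invertible_left_inverse matrix_left_invertible_ker)
    let ?S = "matrix_inv (A + H)"
    have "?S = ?R - ?S ** H ** ?R"
      using matrix_inv_resolvent[OF inv inv'] by simp
    then have "norm ?S \<le> norm ?R + norm (?S ** H ** ?R)"
      by (metis norm_triangle_ineq4)
    also have "norm (?S ** H ** ?R) \<le> norm ?S * (a * norm H)"
      using order_trans[OF norm_matrix_mult_le[of "?S ** H" ?R]
          mult_right_mono[OF norm_matrix_mult_le[of ?S H] norm_ge_zero[of ?R]]]
      by (simp add: a_def mult_ac)
    also have "\<dots> \<le> norm ?S * (1/2)"
      using aH by (intro mult_left_mono) auto
    finally show ?thesis
      using inv' by (simp add: a_def)
  qed
  have bl: "bounded_linear (\<lambda>H. - (?R ** H ** ?R))"
    by (intro bounded_linear_minus bounded_linear_compose[OF mm.bounded_linear_left mm.bounded_linear_right])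
  have "((\<lambda>H. norm (matrix_inv (A + H) - ?R - - (?R ** H ** ?R)) / norm H) \<longlongrightarrow> 0) (at 0)"
  proof (rule Lim_null_comparison)
    have "norm (norm (matrix_inv (A + H) - ?R - - (?R ** H ** ?R)) / norm H) \<le> 2 * a ^ 3 * norm H"
      if H: "dist H 0 < 1 / (2 * a)" "H \<noteq> 0" for H
    proof -
      let ?S = "matrix_inv (A + H)"
      have inv': "invertible (A + H)" and bS: "norm ?S \<le> 2 * a"
        using near[of H] H by auto
      have S: "?S = ?R - ?S ** H ** ?R"
        using matrix_inv_resolvent[OF inv inv'] by simp
      have "?S ** H ** ?R = (?R - ?S ** H ** ?R) ** H ** ?R"
        using S by simp
      also have "\<dots> = ?R ** H ** ?R - ?S ** H ** ?R ** H ** ?R"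
        by (simp only: mm.diff_left)
      finally have "?R ** H ** ?R - ?S ** H ** ?R = ?S ** H ** ?R ** H ** ?R"
        by (simp only: eq_diff_eq diff_eq_eq add.commute)
      moreover have "?S - ?R - - (?R ** H ** ?R) = ?R ** H ** ?R - ?S ** H ** ?R"
        by (subst S) simp
      ultimately have "?S - ?R - - (?R ** H ** ?R) = ?S ** H ** ?R ** H ** ?R"
        by simp
      then have "norm (?S - ?R - - (?R ** H ** ?R)) \<le> norm ?S * norm H * a * norm H * a"
        unfolding a_def
        by (simp only:) (intro order_trans[OF norm_matrix_mult_le] mult_right_mono norm_ge_zero order_refl)
      also have "\<dots> \<le> (2 * a) * norm H * a * norm H * a"
        using bS \<open>a > 0\<close> by (intro mult_right_mono) auto
      finally show ?thesis
        using H(2) by (simp add: field_simps power3_eq_cube)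
    qed
    then show "\<forall>\<^sub>F H in at 0. norm (norm (matrix_inv (A + H) - ?R - - (?R ** H ** ?R)) / norm H) \<le> 2 * a ^ 3 * norm H"
      unfolding eventually_at using \<open>a > 0\<close> by (intro exI[of _ "1 / (2 * a)"]) auto
    show "((\<lambda>H. 2 * a ^ 3 * norm H) \<longlongrightarrow> 0) (at (0 :: real^'n^'n))"
      by (intro tendsto_eq_intros) auto
  qed
  then show ?thesis
    unfolding has_derivative_at using bl by simp
qed

subsection \<open>Centring\<close>

text \<open>The orthogonal projection onto the complement of the constant vector; acting from the
  right, it removes the row means.\<close>

definition cmat :: "real^'n^'n" where
  "cmat = (\<chi> i j. (if i = j then 1 else 0) - 1 / real CARD('n))"

lemma centred_eq: "X - Xbar X = X ** cmat"
  by (simp add: Xbar_def cmat_def matrix_matrix_mult_def vec_eq_iff right_diff_distrib sum_subtractf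
      if_distrib[of "(*) _"] sum_divide_distrib cong: if_cong)

lemma transpose_cmat [simp]: "transpose cmat = cmat"
  by (simp add: cmat_def transpose_def vec_eq_iff)

lemma cmat_idem [simp]: "cmat ** cmat = (cmat :: real^'n^'n)"
proof -
  have "Xbar cmat = (0 :: real^'n^'n)"
    by (simp add: Xbar_def cmat_def vec_eq_iff sum_subtractf)
  then show ?thesis
    using centred_eq[of "cmat :: real^'n^'n"] by simp
qed

lemma cmat_idem2 [simp]: "X ** cmat ** cmat = X ** (cmat :: real^'n^'n)"
  by (simp flip: matrix_mul_assoc)

lemma trace_cmat: "trace (cmat :: real^'n^'n) = real CARD('n) - 1"
  by (simp add: trace_def cmat_def field_simps)

section \<open>Positive definite quadratic forms on matrices\<close>

lemma inner_mult_columns: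
  "(Z :: real^'n^'p) \<bullet> (P ** Z) = (\<Sum>j\<in>UNIV. column j Z \<bullet> (P *v column j Z))"
proof -
  have "(P ** Z) $ i $ j = (P *v column j Z) $ i" for i j
    by (simp add: column_def matrix_matrix_mult_def matrix_vector_mult_def)
  then have "Z \<bullet> (P ** Z) = (\<Sum>i\<in>UNIV. \<Sum>j\<in>UNIV. column j Z $ i * (P *v column j Z) $ i)"
    by (simp add: inner_vec_def column_def)
  also have "\<dots> = (\<Sum>j\<in>UNIV. column j Z \<bullet> (P *v column j Z))"
    by (subst sum.swap) (simp add: inner_vec_def)
  finally show ?thesis .
qed

text \<open>The form has a positive minimum on the compact unit sphere. Homogeneity extends the
  bound to all vectors, and summation over the columns extends it to matrices.\<close>

lemma pos_def_coercive:
  fixes P :: "real^'p^'p"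
  assumes "pos_def_mat P"
  obtains l where "l > 0" "\<And>Z :: real^'n^'p. l * (norm Z)\<^sup>2 \<le> Z \<bullet> (P ** Z)"
proof -
  have cont: "continuous_on (sphere 0 1) (\<lambda>x. x \<bullet> (P *v x))"
    by (intro continuous_intros matrix_vector_mult_linear_continuous_on)
  obtain x0 where x0: "x0 \<in> sphere 0 1" "\<And>x. x \<in> sphere 0 1 \<Longrightarrow> x0 \<bullet> (P *v x0) \<le> x \<bullet> (P *v x)"
    using continuous_attains_inf[OF compact_sphere _ cont] by (auto simp: sphere_eq_empty)
  let ?l = "x0 \<bullet> (P *v x0)"
  have l: "?l > 0"
  proof -
    have "x0 \<noteq> 0"
      using x0(1) by auto
    then show ?thesis
      using assms by (simp add: pos_def_mat_def)
  qed
  have vec: "?l * (norm x)\<^sup>2 \<le> x \<bullet> (P *v x)" for x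
  proof (cases "x = 0")
    case False
    let ?u = "(1 / norm x) *\<^sub>R x"
    have "?l \<le> ?u \<bullet> (P *v ?u)"
      using False by (intro x0(2)) auto
    also have "\<dots> = (x \<bullet> (P *v x)) / (norm x)\<^sup>2"
      by (simp add: matrix_vector_mult_scaleR power2_eq_square)
    finally show ?thesis
      using False by (simp add: field_simps)
  qed simp
  have "?l * (norm Z)\<^sup>2 \<le> Z \<bullet> (P ** Z)" for Z :: "real^'n^'p"
    unfolding norm_sq_columns sum_distrib_left inner_mult_columns[of Z] by (simp add: sum_mono vec)
  then show ?thesis
    by (rule that[OF l])
qed

text \<open>Every \<open>x\<close> is \<open>S\<close> applied to \<open>?P *v x\<close>, so the
  form of the inverse at \<open>x\<close> is the form of \<open>S\<close> at that vector.\<close>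

lemma pos_def_inv:
  fixes S :: "real^'p^'p"
  assumes S: "pos_def_mat S"
  shows "invertible S" "pos_def_mat (matrix_inv S)"
proof -
  have "x = 0" if "S *v x = 0" for x
  proof (rule ccontr)
    assume "x \<noteq> 0"
    then have "x \<bullet> (S *v x) > 0"
      using S by (simp add: pos_def_mat_def)
    then show False
      using that by simp
  qed
  then show inv: "invertible S"
    by (meson invertible_left_inverse matrix_left_invertible_ker)
  let ?P = "matrix_inv S"
  have "transpose ?P ** transpose S = mat 1"
    using arg_cong[OF matrix_inv_mult(1)[OF inv], of transpose]
    by (simp only: matrix_transpose_mul transpose_mat)
  then have "transpose ?P ** S = mat 1"
    using S by (simp add: pos_def_mat_def)
  then have t: "transpose ?P = ?P"
    using matrix_inv_unique by metis
  have "x \<bullet> (?P *v x) > 0" if "x \<noteq> 0" for x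
  proof -
    have e: "S *v (?P *v x) = x"
      by (simp add: matrix_vector_mul_assoc matrix_inv_mult[OF inv])
    then have "?P *v x \<noteq> 0"
      using that by auto
    then have "(?P *v x) \<bullet> (S *v (?P *v x)) > 0"
      using S by (auto simp: pos_def_mat_def)
    then show ?thesis
      by (simp add: e inner_commute)
  qed
  then show "pos_def_mat ?P"
    using t by (simp add: pos_def_mat_def)
qed

text \<open>Turns a bound by the loss into a majorant of \<open>f / w\<close>; \<open>s\<close> will
  be the coefficient of the singular field, assumed nonzero for contradiction.\<close>

lemma norm_le_norm_if_scaled_le:
  fixes s t B :: real
  assumes "s \<noteq> 0" "t \<ge> 0" "s\<^sup>2 * t \<le> B"
  shows "norm t \<le> norm ((1 / s\<^sup>2) * B)"
proof -
  have "t \<le> (1 / s\<^sup>2) * B"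
    using assms by (simp add: field_simps)
  then have "t \<le> \<bar>(1 / s\<^sup>2) * B\<bar>"
    using abs_ge_self order_trans by blast
  then show ?thesis
    using assms(2) by (simp only: real_norm_def abs_of_nonneg)
qed

lemma matnormal_density_eq:
  fixes Th X :: "real^'n^'p"
  shows "matnormal_density Th S X =
    ((2 * pi) powr (- real CARD('p) / 2) * det S powr (- 1 / 2)) ^ CARD('n) * gker ((**) (matrix_inv S)) Th X"
proof -
  have "column j X - column j Th = column j (X - Th)" for j
    by (simp add: column_def vec_eq_iff)
  then show ?thesis
    unfolding matnormal_density_def gker_def inner_mult_columns
    by (simp add: prod.distrib sum_distrib_left exp_sum flip: sum_negf)
qed

lemma loss_eq:
  fixes E Th :: "real^'n^'p"
  shows "real CARD('n) * real CARD('p) * loss S Th E = (E - Th) \<bullet> (matrix_inv S ** (E - Th))"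
  by (simp add: loss_def inner_mat_trace matrix_mul_assoc)

lemma bounded_linear_trace: "bounded_linear (trace :: real^'n^'n \<Rightarrow> real)"
  unfolding trace_def [abs_def]
  by (intro bounded_linear_sum bounded_linear_compose[OF bounded_linear_vec_nth bounded_linear_vec_nth])

text \<open>\<open>has_bochner_integral\<close> records integrability along with the value 0, which
  the bare integral would also return for a function that is not integrable.\<close>

lemma has_bochner_integral_dominated_limit:
  fixes s :: "nat \<Rightarrow> 'a::euclidean_space \<Rightarrow> real"
  assumes "g \<in> borel_measurable lborel" "\<And>k. s k \<in> borel_measurable lborel"
    and "integrable lborel W"
    and "AE x in lborel. (\<lambda>k. s k x) \<longlonglongrightarrow> g x"
    and "\<And>k. AE x in lborel. norm (s k x) \<le> W x"
    and "\<And>k. integral\<^sup>L lborel (s k) = 0"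
  shows "has_bochner_integral lborel g 0"
proof -
  have "(\<lambda>k. integral\<^sup>L lborel (s k)) \<longlonglongrightarrow> integral\<^sup>L lborel g"
    by (rule integral_dominated_convergence[where w = W]) (use assms in auto)
  then have "integral\<^sup>L lborel g = 0"
    using assms(6) LIMSEQ_unique[OF _ tendsto_const] by force
  moreover have "integrable lborel g"
    by (rule integrable_dominated_convergence[where w = W and s = s]) (use assms in auto)
  ultimately show ?thesis
    by (simp add: has_bochner_integral_iff)
qed

text \<open>Coercivity is recorded for two shapes, since the column type is fixed within a locale:
  the form on \<open>p x n\<close> matrices gives the Gaussian decay and the lower bound for
  \<open>w\<close>, the one on square matrices bounds the ridge inverse.\<close>

locale centred_gaussian =
  fixes P :: "real^'p^'p" and la :: real and Th :: "real^'n^'p"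
  assumes tP: "transpose P = P"
    and la: "la > 0"
    and coe_n: "\<And>Z :: real^'n^'p. la * (norm Z)\<^sup>2 \<le> Z \<bullet> (P ** Z)"
    and coe_p: "\<And>Z :: real^'p^'p. la * (norm Z)\<^sup>2 \<le> Z \<bullet> (P ** Z)"
    and n2: "CARD('n) \<ge> 2"
begin

lemma symP: "(P ** (x :: real^'k^'p)) \<bullet> y = x \<bullet> (P ** y)"
  by (simp add: inner_matrix_mult_left tP)

sublocale gaussian "(**) P :: real^'n^'p \<Rightarrow> real^'n^'p" la Th
proof (rule gaussian.intro)
  show "linear ((**) P :: real^'n^'p \<Rightarrow> real^'n^'p)"
    using mm.bounded_linear_right bounded_linear.linear by blast
qed (simp_all add: la coe_n symP)

abbreviation Y :: "real^'n^'p \<Rightarrow> real^'n^'p" where "Y X \<equiv> X ** cmat"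

definition w :: "real^'n^'p \<Rightarrow> real" where "w X = Y X \<bullet> (P ** Y X)"

text \<open>The dimension of the space of centred matrices, hence the divergence of \<open>Y\<close>
  and the dimension in which \<open>1 / w\<close> has an inverse-square singularity.\<close>

definition m :: real where "m = real CARD('p) * (real CARD('n) - 1)"

definition Wm :: "real^'n^'p \<Rightarrow> real^'p^'p" where "Wm X = Y X ** transpose (Y X) ** P"

definition V :: "real \<Rightarrow> real^'n^'p \<Rightarrow> real^'p^'p" where "V al X = Vmat al (Wm X)"

lemma V_eq: "V al X = matrix_inv (Wm X + al *\<^sub>R mat 1)"
  by (simp add: V_def Vmat_def)

lemma trace_Wm: "trace (Wm X) = w X"
proof -
  have "trace (Y X ** (transpose (Y X) ** P)) = trace ((transpose (Y X) ** P) ** Y X)"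
    by (rule trace_mul_sym)
  then show ?thesis
    by (simp add: Wm_def w_def inner_mat_trace matrix_mul_assoc)
qed

lemma w_lower: "la * (norm (Y X))\<^sup>2 \<le> w X"
  unfolding w_def by (rule coe_n)

lemma w_nonneg [simp]: "w X \<ge> 0"
  using w_lower[of X] la by (meson mult_nonneg_nonneg order_trans less_imp_le zero_le_power2)

lemma w_eq_0_iff: "w X = 0 \<longleftrightarrow> Y X = 0"
proof
  assume "w X = 0"
  then have "la * (norm (Y X))\<^sup>2 \<le> 0"
    using w_lower[of X] by simp
  then show "Y X = 0"
    using la by (simp add: mult_le_0_iff)
qed (simp add: w_def)

lemma norm_Y_le: "norm (Y X) \<le> norm (cmat :: real^'n^'n) * norm X"
  using norm_matrix_mult_le[of X cmat] by (simp add: mult.commute)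

lemma bl_Y: "bounded_linear Y"
  by (rule mm.bounded_linear_left)

lemma Y_deriv: "(Y has_derivative Y) (at X)"
  by (rule bounded_linear_imp_has_derivative[OF bl_Y])

text \<open>The centring projection is symmetric and idempotent, so \<open>P ** Y X\<close> is
  already centred and pairing it with \<open>Y h\<close> or with \<open>h\<close> gives the same
  number.\<close>

lemma w_deriv: "(w has_derivative (\<lambda>h. 2 * ((P ** Y X) \<bullet> h))) (at X)"
proof -
  have "((\<lambda>X. P ** Y X) has_derivative (\<lambda>h. P ** Y h)) (at X)"
    by (rule bounded_linear.has_derivative[OF mm.bounded_linear_right Y_deriv])
  from has_derivative_inner[OF Y_deriv this] show ?thesis
    unfolding w_def [abs_def]
  proof (rule has_derivative_eq_rhs, intro ext)
    fix h
    have "(P ** Y X) \<bullet> Y h = (P ** Y X) \<bullet> h"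
      by (subst inner_commute, subst inner_matrix_mult_right) (simp add: inner_commute flip: matrix_mul_assoc)
    then show "Y X \<bullet> (P ** Y h) + Y h \<bullet> (P ** Y X) = 2 * ((P ** Y X) \<bullet> h)"
      by (metis inner_commute mult_2 symP)
  qed
qed

lemma cont_w: "continuous_on UNIV w"
  using w_deriv by (intro continuous_at_imp_continuous_on ballI) (rule has_derivative_continuous)

lemma meas_w [measurable]: "w \<in> borel_measurable borel"
  using cont_w by (rule borel_measurable_continuous_onI)

lemma meas_Y [measurable]: "Y \<in> borel_measurable borel"
  by (intro borel_measurable_continuous_onI linear_continuous_on bl_Y)

text \<open>Where \<open>w\<close> vanishes, so does each entry of \<open>Y\<close>. One diagonal
  entry \<open>1 - 1/n\<close> of \<open>cmat\<close> is nonzero since \<open>n \<ge> 2\<close>, so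
  an entry of \<open>Y\<close> is a nonzero linear functional and the null set lies in a
  hyperplane.\<close>

lemma AE_w_nonzero: "AE X in lborel. w X \<noteq> 0"
proof -
  obtain i :: 'p and j :: 'n where True by blast
  let ?a = "axis i (axis j 1) ** cmat :: real^'n^'p"
  have 1: "?a \<bullet> X = Y X $ i $ j" for X :: "real^'n^'p"
    by (subst inner_matrix_mult_right) (simp add: inner_mat_axis)
  have "?a \<bullet> axis i (axis j 1) = cmat $ j $ (j :: 'n)"
    unfolding 1 by (simp add: matrix_matrix_mult_def axis_def if_distrib[of "\<lambda>x. x * _"] cong: if_cong)
  also have "\<dots> \<noteq> 0"
    using n2 by (simp add: cmat_def)
  finally have "?a \<noteq> 0"
    by auto
  then have "negligible {X. ?a \<bullet> X = 0}"
    by (intro negligible_hyperplane) auto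
  moreover have cl: "closed {X. ?a \<bullet> X = 0}"
    by (rule closed_hyperplane)
  ultimately have "{X. ?a \<bullet> X = 0} \<in> null_sets lborel"
    by (simp add: negligible_iff_null_sets null_sets_completion_iff borel_closed)
  then have "AE X in lborel. X \<notin> {X. ?a \<bullet> X = 0}"
    by (rule AE_not_in)
  then show ?thesis
    by eventually_elim (auto simp: w_eq_0_iff 1)
qed

abbreviation qf :: "real^'n^'p \<Rightarrow> real" where "qf Z \<equiv> Z \<bullet> (P ** Z)"

lemma qf_nonneg: "qf Z \<ge> 0"
  using coe_n[of Z] la by (meson mult_nonneg_nonneg order_trans less_imp_le zero_le_power2)

lemma young: "\<bar>u \<bullet> (P ** v)\<bar> \<le> (u \<bullet> (P ** u) + v \<bullet> (P ** v)) / 2" for u v :: "real^'n^'p"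
proof -
  have s: "v \<bullet> (P ** u) = u \<bullet> (P ** v)"
    by (metis inner_commute symP)
  show ?thesis
    using qf_nonneg[of "u + v"] qf_nonneg[of "u - v"]
    by (simp add: mm.add_right mm.diff_right inner_add_left inner_add_right inner_diff_left inner_diff_right s)
qed

text \<open>A by-product of Stein's identity for the field \<open>X - Th\<close>, whose pairing with
  \<open>P ** (X - Th)\<close> is the form itself.\<close>

lemma integrable_qf: "integrable lborel (\<lambda>X. f X * ((X - Th) \<bullet> (P ** (X - Th))))"
  using stein(1)[of "\<lambda>X. X - Th" "\<lambda>_ h. h" "1 + norm Th"]
proof this
  fix x :: "real^'n^'p"
  show "((\<lambda>X. X - Th) has_derivative (\<lambda>h. h)) (at x)"
    by (auto intro!: derivative_eq_intros)
  have "norm (x - Th) \<le> norm x + norm Th"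
    by (rule norm_triangle_ineq4)
  also have "\<dots> \<le> (1 + norm Th) * (1 + norm x)"
    by (simp add: algebra_simps)
  finally show "norm (x - Th) \<le> (1 + norm Th) * (1 + norm x)" .
  show "norm b \<le> (1 + norm Th) * (1 + (norm x)\<^sup>2)" if "b \<in> Basis" for b :: "real^'n^'p"
    using that mult_mono[of 1 "1 + norm Th" 1 "1 + (norm x)\<^sup>2"] by simp
qed

subsection \<open>Stein's identity for \<open>Y / w\<close>\<close>

text \<open>\<open>F 0\<close> is the singular field of the estimator; where \<open>w\<close>
  vanishes its value is 0.\<close>

definition F :: "real \<Rightarrow> real^'n^'p \<Rightarrow> real^'n^'p" where
  "F e X = (1 / (w X + e)) *\<^sub>R Y X"

definition F' :: "real \<Rightarrow> real^'n^'p \<Rightarrow> real^'n^'p \<Rightarrow> real^'n^'p" where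
  "F' e X h = (1 / (w X + e)) *\<^sub>R Y h - (2 * ((P ** Y X) \<bullet> h) / (w X + e)\<^sup>2) *\<^sub>R Y X"

lemma F_deriv:
  assumes "w X + e \<noteq> 0"
  shows "(F e has_derivative F' e X) (at X)"
proof -
  have "((\<lambda>X. inverse (w X + e)) has_derivative
      (\<lambda>h. - (inverse (w X + e) * (2 * ((P ** Y X) \<bullet> h) + 0) * inverse (w X + e)))) (at X)"
    by (rule Deriv.has_derivative_inverse[OF assms has_derivative_add[OF w_deriv has_derivative_const]])
  from has_derivative_scaleR[OF this Y_deriv] show ?thesis
    unfolding F_def [abs_def] F'_def [abs_def] inverse_eq_divide
    by (rule has_derivative_eq_rhs) (simp add: fun_eq_iff power2_eq_square)
qed

text \<open>The linear map \<open>Y\<close> has trace \<open>m\<close>, and the gradient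
  \<open>2 * P ** Y\<close> of \<open>w\<close> paired with \<open>Y\<close> gives
  \<open>2 * w\<close>.\<close>

lemma F_div: "(\<Sum>b\<in>Basis. b \<bullet> F' e X b) = m / (w X + e) - 2 * w X / (w X + e)\<^sup>2"
proof -
  have 1: "(\<Sum>b\<in>Basis. b \<bullet> Y b) = m"
    using sum_Basis_trace_mult[of "mat 1 :: real^'p^'p" "cmat :: real^'n^'n"]
    by (simp add: trace_I trace_cmat m_def)
  have "(\<Sum>b\<in>Basis. ((P ** Y X) \<bullet> b) * (b \<bullet> Y X)) = w X"
    using euclidean_inner[of "P ** Y X" "Y X"] by (simp add: w_def inner_commute)
  then have "(\<Sum>b\<in>Basis. 2 / (w X + e)\<^sup>2 * (((P ** Y X) \<bullet> b) * (b \<bullet> Y X))) = 2 * w X / (w X + e)\<^sup>2"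
    by (simp only: sum_distrib_left[symmetric]) simp
  then have 2: "(\<Sum>b\<in>Basis. 2 * ((P ** Y X) \<bullet> b) / (w X + e)\<^sup>2 * (b \<bullet> Y X)) = 2 * w X / (w X + e)\<^sup>2"
    by (simp add: mult_ac)
  show ?thesis
    unfolding F'_def inner_diff_right inner_scaleR_right sum_subtractf 2
    by (simp only: sum_distrib_left[symmetric] 1) simp
qed

lemma F_qf: "F e X \<bullet> (P ** F e X) = w X / (w X + e)\<^sup>2"
  by (simp add: F_def mm.scaleR_right w_def power2_eq_square)

lemma w_frac_le:
  assumes "e > 0"
  shows "w X / (w X + e)\<^sup>2 \<le> 1 / (w X + e)"
proof -
  have p: "w X + e > 0" using assms w_nonneg[of X] by linarith
  have "w X / (w X + e)\<^sup>2 \<le> (w X + e) / (w X + e)\<^sup>2"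
    using assms by (intro divide_right_mono) auto
  then show ?thesis
    using p by (simp add: power2_eq_square)
qed

lemma stein_F:
  assumes e: "e > 0"
  shows "integrable lborel (\<lambda>X. f X * (F e X \<bullet> (P ** (X - Th))))"
    and "integrable lborel (\<lambda>X. f X * (m / (w X + e) - 2 * w X / (w X + e)\<^sup>2))"
    and "(\<integral>X. f X * (F e X \<bullet> (P ** (X - Th))) \<partial>lborel) =
         (\<integral>X. f X * (m / (w X + e) - 2 * w X / (w X + e)\<^sup>2) \<partial>lborel)"
proof -
  define c where "c = norm (cmat :: real^'n^'n)"
  \<comment> \<open>The first term bounds \<open>F e\<close> and the part of its derivative that
    varies \<open>Y\<close>; the second bounds the part that varies the weight
    \<open>1 / (w + e)\<close>.\<close>
  define K where "K = c / e + 2 * norm P * c\<^sup>2 / e\<^sup>2"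
  have c0: "c \<ge> 0" by (simp add: c_def)
  have pos: "w X + e \<ge> e" for X by simp
  have d: "(F e has_derivative F' e X) (at X)" for X
    using e pos[of X] by (intro F_deriv) linarith
  have b1: "norm (F e X) \<le> K * (1 + norm X)" for X
  proof -
    have "norm (F e X) = norm (Y X) / (w X + e)"
      using e w_nonneg[of X] by (simp add: F_def)
    also have "\<dots> \<le> (c * norm X) / e"
      using norm_Y_le[of X] e pos[of X] by (intro frac_le) (auto simp: c_def)
    also have "\<dots> = (c / e) * norm X" by simp
    also have "\<dots> \<le> K * (1 + norm X)"
      using e c0 by (intro mult_mono) (auto simp: K_def)
    finally show ?thesis .
  qed
  have b2: "norm (F' e X b) \<le> K * (1 + (norm X)\<^sup>2)" if b: "b \<in> Basis" for X b
  proof -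
    have Yb: "norm (Y b) \<le> c"
      using norm_Y_le[of b] b by (simp add: c_def)
    have YX: "norm (Y X) \<le> c * norm X"
      using norm_Y_le[of X] by (simp add: c_def)
    have "\<bar>(P ** Y X) \<bullet> b\<bar> \<le> norm (P ** Y X)"
      using Basis_le_norm[OF b] by simp
    also have "\<dots> \<le> norm P * (c * norm X)"
      by (rule order_trans[OF norm_matrix_mult_le mult_left_mono[OF YX]]) simp
    finally have Pb: "\<bar>(P ** Y X) \<bullet> b\<bar> \<le> norm P * (c * norm X)" .
    have "norm (F' e X b) \<le> norm (Y b) / (w X + e) + (2 * \<bar>(P ** Y X) \<bullet> b\<bar> / (w X + e)\<^sup>2) * norm (Y X)"
      unfolding F'_def using e w_nonneg[of X]
      by (intro order_trans[OF norm_triangle_ineq4]) (simp add: abs_mult)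
    also have "\<dots> \<le> c / e + (2 * (norm P * (c * norm X)) / e\<^sup>2) * (c * norm X)"
      using e pos[of X] Yb YX Pb c0 by (intro add_mono mult_mono frac_le power_mono) auto
    also have "\<dots> = (c / e) * 1 + (2 * norm P * c\<^sup>2 / e\<^sup>2) * (norm X)\<^sup>2"
      by (simp add: power2_eq_square)
    also have "\<dots> \<le> (c / e) * (1 + (norm X)\<^sup>2) + (2 * norm P * c\<^sup>2 / e\<^sup>2) * (1 + (norm X)\<^sup>2)"
      using e c0 by (intro add_mono mult_left_mono) auto
    finally show ?thesis by (simp add: K_def algebra_simps)
  qed
  show "integrable lborel (\<lambda>X. f X * (F e X \<bullet> (P ** (X - Th))))"
    and "integrable lborel (\<lambda>X. f X * (m / (w X + e) - 2 * w X / (w X + e)\<^sup>2))"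
    and "(\<integral>X. f X * (F e X \<bullet> (P ** (X - Th))) \<partial>lborel) =
         (\<integral>X. f X * (m / (w X + e) - 2 * w X / (w X + e)\<^sup>2) \<partial>lborel)"
    using stein[OF d b1 b2] unfolding F_div by auto
qed

text \<open>Let \<open>I\<close> be the integral of \<open>f / (w + e)\<close>. The divergence of
  \<open>F e\<close> is at least \<open>(m - 2) / (w + e)\<close>, hence at least
  \<open>1 / (w + e)\<close>; Stein's identity and Young's inequality then give
  \<open>I \<le> (I + B) / 2\<close>, so \<open>I \<le> B\<close> with \<open>B\<close> independent
  of \<open>e\<close>.\<close>

lemma hardy:
  assumes m: "m \<ge> 3"
  shows "integrable lborel (\<lambda>X. f X / w X)"
proof (rule integrableI_bounded)
  let ?q = "\<lambda>X. (X - Th) \<bullet> (P ** (X - Th))"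
  let ?e = "\<lambda>k. 1 / real (Suc k)"
  define B where "B = (\<integral>X. f X * ?q X \<partial>lborel)"
  \<comment> \<open>Finiteness for each positive \<open>e\<close> is what allows
    \<open>I / 2\<close> to be subtracted from both sides.\<close>
  have int0: "integrable lborel (\<lambda>X. f X / (w X + e))" if e: "e > 0" for e
  proof -
    have "integrable lborel (\<lambda>X. f X * (1 / (w X + e)))"
    proof (rule integrable_bounded_poly[where K = "1 / e"])
      show "\<bar>1 / (w X + e)\<bar> \<le> (1 / e) * (1 + (norm X)\<^sup>2)" for X
      proof -
        have "1 / (w X + e) \<le> 1 / e"
          using e w_nonneg[of X] by (intro divide_left_mono mult_pos_pos add_nonneg_pos) auto
        also have "\<dots> \<le> (1 / e) * (1 + (norm X)\<^sup>2)"
          using e by (simp add: mult_le_cancel_left1 divide_right_mono)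
        finally show ?thesis using e w_nonneg[of X] by simp
      qed
    qed simp
    then show ?thesis by simp
  qed
  have bd: "(\<integral>X. f X / (w X + e) \<partial>lborel) \<le> B" if e: "e > 0" for e
  proof -
    have "(\<integral>X. f X / (w X + e) \<partial>lborel) \<le> (\<integral>X. f X * (m / (w X + e) - 2 * w X / (w X + e)\<^sup>2) \<partial>lborel)"
    proof (rule integral_mono[OF int0[OF e] stein_F(2)[OF e]])
      fix X
      have p: "w X + e > 0" using e w_nonneg[of X] by linarith
      note w_frac_le[OF e, of X]
      moreover have "3 / (w X + e) \<le> m / (w X + e)"
        using p m by (intro divide_right_mono) auto
      ultimately have "1 / (w X + e) \<le> m / (w X + e) - 2 * w X / (w X + e)\<^sup>2"
        by (simp add: add_divide_distrib)
      from mult_left_mono[OF this, of "f X"]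
      show "f X / (w X + e) \<le> f X * (m / (w X + e) - 2 * w X / (w X + e)\<^sup>2)"
        by simp
    qed
    also have "\<dots> = (\<integral>X. f X * (F e X \<bullet> (P ** (X - Th))) \<partial>lborel)"
      by (rule stein_F(3)[OF e, symmetric])
    also have "\<dots> \<le> (\<integral>X. (f X / (w X + e) + f X * ?q X) / 2 \<partial>lborel)"
    proof (rule integral_mono[OF stein_F(1)[OF e]])
      show "integrable lborel (\<lambda>X. (f X / (w X + e) + f X * ?q X) / 2)"
        using int0[OF e] integrable_qf by simp
      fix X
      have p: "w X + e > 0" using e w_nonneg[of X] by linarith
      have "F e X \<bullet> (P ** (X - Th)) \<le> (w X / (w X + e)\<^sup>2 + ?q X) / 2"
        using young[of "F e X" "X - Th"] e by (simp add: F_qf abs_le_iff)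
      also have "\<dots> \<le> (1 / (w X + e) + ?q X) / 2"
        using w_frac_le[OF e, of X] by (intro divide_right_mono add_right_mono) auto
      finally have "f X * (F e X \<bullet> (P ** (X - Th))) \<le> f X * ((1 / (w X + e) + ?q X) / 2)"
        by (rule mult_left_mono) simp
      then show "f X * (F e X \<bullet> (P ** (X - Th))) \<le> (f X / (w X + e) + f X * ?q X) / 2"
        by (simp add: algebra_simps add_divide_distrib)
    qed
    also have "\<dots> = ((\<integral>X. f X / (w X + e) \<partial>lborel) + B) / 2"
      using int0[OF e] integrable_qf by (simp add: B_def)
    finally show ?thesis by simp
  qed
  \<comment> \<open>Fatou's lemma carries the uniform bound \<open>B\<close> to the limit
    \<open>e = 0\<close>.\<close>
  have "(\<integral>\<^sup>+X. ennreal (norm (f X / w X)) \<partial>lborel) = (\<integral>\<^sup>+X. liminf (\<lambda>k. ennreal (f X / (w X + ?e k))) \<partial>lborel)"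
  proof (rule nn_integral_cong_AE)
    show "AE X in lborel. ennreal (norm (f X / w X)) = liminf (\<lambda>k. ennreal (f X / (w X + ?e k)))"
      using AE_w_nonzero
    proof eventually_elim
      fix X assume "w X \<noteq> 0"
      then have "(\<lambda>k. f X / (w X + ?e k)) \<longlonglongrightarrow> f X / (w X + 0)"
        by (intro tendsto_intros LIMSEQ_Suc[OF lim_1_over_n]) auto
      then have "(\<lambda>k. ennreal (f X / (w X + ?e k))) \<longlonglongrightarrow> ennreal (f X / w X)"
        by (intro tendsto_ennrealI) simp
      then have "liminf (\<lambda>k. ennreal (f X / (w X + ?e k))) = ennreal (f X / w X)"
        by (rule lim_imp_Liminf[OF trivial_limit_sequentially])
      then show "ennreal (norm (f X / w X)) = liminf (\<lambda>k. ennreal (f X / (w X + ?e k)))"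
        unfolding \<open>liminf _ = _\<close> by simp
    qed
  qed
  also have "\<dots> \<le> liminf (\<lambda>k. (\<integral>\<^sup>+X. ennreal (f X / (w X + ?e k)) \<partial>lborel))"
    by (rule nn_integral_liminf) simp
  also have "\<dots> \<le> ennreal B"
  proof (rule Liminf_le)
    show "\<forall>\<^sub>F k in sequentially. (\<integral>\<^sup>+X. ennreal (f X / (w X + ?e k)) \<partial>lborel) \<le> ennreal B"
      by (rule always_eventually) (auto intro!: ennreal_leI bd simp: nn_integral_eq_integral[OF int0])
  qed simp
  finally show "(\<integral>\<^sup>+X. ennreal (norm (f X / w X)) \<partial>lborel) < \<infinity>"
    by (simp add: le_less_trans)
qed simp

lemma stein_F_limit:
  assumes int: "integrable lborel (\<lambda>X. f X / w X)"
  shows "has_bochner_integral lborel (\<lambda>X. f X * (F 0 X \<bullet> (P ** (X - Th)) - (m - 2) / w X)) 0"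
proof (rule has_bochner_integral_dominated_limit)
  let ?q = "\<lambda>X. (X - Th) \<bullet> (P ** (X - Th))"
  let ?e = "\<lambda>k. 1 / real (Suc k)"
  let ?s = "\<lambda>k X. f X * (F (?e k) X \<bullet> (P ** (X - Th))) - f X * (m / (w X + ?e k) - 2 * w X / (w X + ?e k)\<^sup>2)"
  have [measurable]: "F e \<in> borel_measurable borel" for e
    unfolding F_def by measurable
  show "(\<lambda>X. f X * (F 0 X \<bullet> (P ** (X - Th)) - (m - 2) / w X)) \<in> borel_measurable lborel"
    by measurable
  show "?s k \<in> borel_measurable lborel" for k
    by measurable
  \<comment> \<open>In the constant, \<open>\<bar>m\<bar>\<close> and 2 come from the two terms of
    the divergence and 1 from Young's inequality, all uniformly in the regularization.\<close>
  show "integrable lborel (\<lambda>X. (\<bar>m\<bar> + 3) * (f X / w X) + f X * ?q X)"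
    by (intro Bochner_Integration.integrable_add Bochner_Integration.integrable_mult_right int integrable_qf)
  show "integral\<^sup>L lborel (?s k) = 0" for k
    using stein_F[of "?e k"] by simp
  show "AE X in lborel. (\<lambda>k. ?s k X) \<longlonglongrightarrow> f X * (F 0 X \<bullet> (P ** (X - Th)) - (m - 2) / w X)"
    using AE_w_nonzero
  proof eventually_elim
    fix X assume nz: "w X \<noteq> 0"
    have "(\<lambda>k. ?s k X) \<longlonglongrightarrow> f X * ((1 / (w X + 0)) *\<^sub>R Y X \<bullet> (P ** (X - Th))) -
        f X * (m / (w X + 0) - 2 * w X / (w X + 0)\<^sup>2)"
      unfolding F_def using nz by (intro tendsto_intros LIMSEQ_Suc[OF lim_1_over_n]) auto
    then show "(\<lambda>k. ?s k X) \<longlonglongrightarrow> f X * (F 0 X \<bullet> (P ** (X - Th)) - (m - 2) / w X)"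
      using nz by (simp add: F_def power2_eq_square algebra_simps diff_divide_distrib)
  qed
  show "AE X in lborel. norm (?s k X) \<le> (\<bar>m\<bar> + 3) * (f X / w X) + f X * ?q X" for k
    using AE_w_nonzero
  proof eventually_elim
    fix X assume nz: "w X \<noteq> 0"
    then have p: "w X > 0" using w_nonneg[of X] by linarith
    define e where "e = ?e k"
    have e: "e > 0" by (simp add: e_def)
    have q: "?q X \<ge> 0"
      by (rule qf_nonneg)
    have i1: "1 / (w X + e) \<le> 1 / w X"
      using p e by (intro divide_left_mono) auto
    have i2: "w X / (w X + e)\<^sup>2 \<le> 1 / w X"
      using i1 w_frac_le[OF e, of X] by linarith
    have "\<bar>F e X \<bullet> (P ** (X - Th))\<bar> \<le> 1 / w X + ?q X"
      using young[of "F e X" "X - Th"] e i2 q p by (simp add: F_qf)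
    moreover have "\<bar>m / (w X + e)\<bar> \<le> \<bar>m\<bar> * (1 / w X)"
      using p e i1 mult_left_mono[OF i1, of "\<bar>m\<bar>"] by (simp add: abs_divide)
    moreover have "\<bar>2 * w X / (w X + e)\<^sup>2\<bar> \<le> 2 * (1 / w X)"
      using i2 p by simp
    ultimately have "\<bar>F e X \<bullet> (P ** (X - Th)) - (m / (w X + e) - 2 * w X / (w X + e)\<^sup>2)\<bar>
        \<le> (\<bar>m\<bar> + 3) * (1 / w X) + ?q X"
      by (simp only: distrib_right)
    from mult_left_mono[OF this, of "f X"]
    have "f X * \<bar>F e X \<bullet> (P ** (X - Th)) - (m / (w X + e) - 2 * w X / (w X + e)\<^sup>2)\<bar>
        \<le> f X * ((\<bar>m\<bar> + 3) * (1 / w X) + ?q X)"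
      by simp
    also have "\<dots> = (\<bar>m\<bar> + 3) * (f X / w X) + f X * ?q X"
      by (simp add: algebra_simps add_divide_distrib)
    finally show "norm (?s k X) \<le> (\<bar>m\<bar> + 3) * (f X / w X) + f X * ?q X"
      unfolding e_def right_diff_distrib[symmetric] real_norm_def abs_mult by simp
  qed
qed


subsection \<open>Stein's identity for \<open>V Y\<close>\<close>

text \<open>\<open>Wm X\<close> is nonnegative for the inner product defined by \<open>P\<close>:
  its form at \<open>Z\<close> is the squared norm of
  \<open>transpose (Y X) ** (P ** Z)\<close>.\<close>

lemma quad_form_ge:
  fixes Z :: "real^'k^'p"
  assumes "al \<ge> 0"
  shows "al * (Z \<bullet> (P ** Z)) \<le> ((Wm X + al *\<^sub>R mat 1) ** Z) \<bullet> (P ** Z)"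
proof -
  have "(Wm X ** Z) \<bullet> (P ** Z) = (Y X ** (transpose (Y X) ** (P ** Z))) \<bullet> (P ** Z)"
    by (simp add: Wm_def matrix_mul_assoc)
  also have "\<dots> = (transpose (Y X) ** (P ** Z)) \<bullet> (transpose (Y X) ** (P ** Z))"
    by (rule inner_matrix_mult_left)
  also have "\<dots> \<ge> 0"
    by simp
  finally show ?thesis
    by (simp add: mm.add_left mm.scaleR_left inner_add_left)
qed

lemma invertible_M:
  assumes al: "al > 0"
  shows "invertible (Wm X + al *\<^sub>R mat 1)"
proof -
  let ?M = "Wm X + al *\<^sub>R mat 1"
  have "x = 0" if x: "?M *v x = 0" for x
  proof -
    \<comment> \<open>The kernel vector is copied into every column, so that coercivity on square
      matrices applies to it.\<close>
    define Z :: "real^'p^'p" where "Z = (\<chi> i j. x $ i)"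
    have "?M ** Z = (\<chi> i j. (?M *v x) $ i)"
      by (simp add: Z_def matrix_matrix_mult_def matrix_vector_mult_def)
    also have "\<dots> = 0"
      unfolding x by (simp add: vec_eq_iff)
    finally have "al * (Z \<bullet> (P ** Z)) \<le> 0"
      using quad_form_ge[of al Z X] al by simp
    then have "Z \<bullet> (P ** Z) \<le> 0"
      using al by (simp add: mult_le_0_iff)
    then have "la * (norm Z)\<^sup>2 \<le> 0"
      using coe_p[of Z] by linarith
    then have "Z = 0"
      using la by (simp add: mult_le_0_iff)
    then show "x = 0"
      by (simp add: Z_def vec_eq_iff)
  qed
  then show ?thesis
    by (meson invertible_left_inverse matrix_left_invertible_ker)
qed

definition K :: real where "K = norm P * norm (mat 1 :: real^'p^'p) / la"

lemma K_nonneg: "K \<ge> 0"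
  using la by (simp add: K_def)

text \<open>Testing the ridge matrix on its own inverse bounds \<open>al * la * (norm V)^2\<close>
  by the pairing of the identity with \<open>P ** V\<close>, which is only linear in
  \<open>V\<close>. The result depends on \<open>X\<close> through \<open>al\<close> alone.\<close>

lemma norm_V:
  assumes al: "al > 0"
  shows "norm (V al X) \<le> K / al"
proof (cases "V al X = 0")
  case True
  then show ?thesis using K_nonneg al by simp
next
  case False
  let ?V = "V al X" and ?M = "Wm X + al *\<^sub>R mat 1"
  have "al * (la * (norm ?V)\<^sup>2) \<le> al * (?V \<bullet> (P ** ?V))"
    using al by (intro mult_left_mono coe_p) auto
  also have "\<dots> \<le> (?M ** ?V) \<bullet> (P ** ?V)"
    using al by (intro quad_form_ge) auto
  also have "\<dots> = mat 1 \<bullet> (P ** ?V)"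
    by (simp add: V_eq matrix_inv_mult[OF invertible_M[OF al]])
  also have "\<dots> \<le> norm (mat 1 :: real^'p^'p) * (norm P * norm ?V)"
    by (rule order_trans[OF norm_cauchy_schwarz mult_left_mono[OF norm_matrix_mult_le]]) simp
  finally have "(al * la * norm ?V) * norm ?V \<le> (norm (mat 1 :: real^'p^'p) * norm P) * norm ?V"
    by (simp add: power2_eq_square mult_ac)
  then have "al * la * norm ?V \<le> norm (mat 1 :: real^'p^'p) * norm P"
    using False by simp
  then show ?thesis
    using al la by (simp add: K_def field_simps)
qed

text \<open>The ridge matrix is self-adjoint for the inner product defined by \<open>P\<close>, and
  therefore so is its inverse.\<close>

lemma V_P_sym:
  assumes al: "al > 0"
  shows "transpose (V al X) ** P = P ** V al X"
proof -
  let ?V = "V al X" and ?M = "Wm X + al *\<^sub>R mat 1"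
  note inv = matrix_inv_mult[OF invertible_M[OF al, of X], folded V_eq]
  have "transpose (Wm X) ** P = P ** Wm X"
    by (simp add: Wm_def matrix_transpose_mul tP matrix_mul_assoc)
  then have M: "transpose ?M ** P = P ** ?M"
    by (simp add: linear_add[OF bounded_linear.linear[OF bounded_linear_transpose]] transpose_scalar
        mm.add_left mm.add_right mm.scaleR_left mm.scaleR_right)
  have t: "transpose ?V ** transpose ?M = mat 1"
    using arg_cong[OF inv(1), of transpose] by (simp only: matrix_transpose_mul transpose_mat)
  have "transpose ?V ** P = transpose ?V ** P ** (?M ** ?V)"
    by (simp add: inv)
  also have "\<dots> = transpose ?V ** (P ** ?M) ** ?V"
    by (simp only: matrix_mul_assoc)
  also have "\<dots> = transpose ?V ** (transpose ?M ** P) ** ?V"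
    by (simp only: M)
  also have "\<dots> = (transpose ?V ** transpose ?M) ** P ** ?V"
    by (simp only: matrix_mul_assoc)
  also have "\<dots> = P ** ?V"
    by (simp add: t)
  finally show ?thesis .
qed

text \<open>From \<open>V ** (Wm + al I) = I\<close>. This identity is the origin of the
  \<open>- p\<close> in the coefficient of \<open>trace V\<close> and of the term
  \<open>al * (trace V)^2\<close> in the risk estimator.\<close>

lemma V_W:
  assumes al: "al > 0"
  shows "trace (V al X ** Wm X) = real CARD('p) - al * trace (V al X)"
proof -
  have "V al X ** (Wm X + al *\<^sub>R mat 1) = mat 1"
    unfolding V_eq by (rule matrix_inv_mult(2)[OF invertible_M[OF al]])
  then have "V al X ** Wm X = mat 1 - al *\<^sub>R V al X"
    by (simp add: mm.add_right mm.scaleR_right eq_diff_eq)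
  then show ?thesis
    by (simp add: trace_sub trace_I trace_scaleR)
qed

lemma trace_YPVY:
  fixes A :: "real^'p^'p"
  shows "trace (transpose (Y X) ** P ** A ** Y X) = trace (A ** Wm X)"
proof -
  have "trace ((transpose (Y X) ** P) ** (A ** Y X)) = trace ((A ** Y X) ** (transpose (Y X) ** P))"
    by (rule trace_mul_sym)
  then show ?thesis
    by (simp add: Wm_def matrix_mul_assoc)
qed

lemma inner_VY:
  assumes "al > 0"
  shows "(V al X ** Y X) \<bullet> (P ** (B ** Y X)) = trace (V al X ** B ** Wm X)"
proof -
  have "(V al X ** Y X) \<bullet> (P ** (B ** Y X)) = trace (transpose (Y X) ** (transpose (V al X) ** P) ** B ** Y X)"
    by (simp add: inner_mat_trace matrix_transpose_mul matrix_mul_assoc)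
  also have "\<dots> = trace (transpose (Y X) ** P ** (V al X ** B) ** Y X)"
    by (simp only: V_P_sym[OF assms] matrix_mul_assoc)
  finally show ?thesis
    by (simp only: trace_YPVY)
qed

lemma inner_Y:
  "Y X \<bullet> (P ** (B ** Y X)) = trace (B ** Wm X)"
  by (simp add: inner_mat_trace matrix_mul_assoc flip: trace_YPVY)

text \<open>The ridge statistic is \<open>al = c0 * w + c1\<close>; letting \<open>c1\<close> tend to 0 regularizes
  the case of a multiple of the trace.\<close>

definition G :: "real \<Rightarrow> real \<Rightarrow> real^'n^'p \<Rightarrow> real^'n^'p" where
  "G c0 c1 X = V (c0 * w X + c1) X ** Y X"

text \<open>The differential of the ridge matrix \<open>Wm X + (c0 * w X + c1) I\<close>; its last
  summand comes from the dependence of the ridge statistic on \<open>w\<close>.\<close>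

definition dM :: "real \<Rightarrow> real^'n^'p \<Rightarrow> real^'n^'p \<Rightarrow> real^'p^'p" where
  "dM c0 X h = (Y h ** transpose (Y X) + Y X ** transpose (Y h)) ** P + (2 * c0 * ((P ** Y X) \<bullet> h)) *\<^sub>R mat 1"

definition G' :: "real \<Rightarrow> real \<Rightarrow> real^'n^'p \<Rightarrow> real^'n^'p \<Rightarrow> real^'n^'p" where
  "G' c0 c1 X h = (let V = V (c0 * w X + c1) X in V ** Y h - V ** dM c0 X h ** V ** Y X)"

text \<open>The divergence of \<open>G c0 c1\<close> in closed form.\<close>

definition D :: "real \<Rightarrow> real \<Rightarrow> real^'n^'p \<Rightarrow> real" where
  "D c0 c1 X = (let al = c0 * w X + c1; V = V al X in
     (real CARD('n) - 1 - real CARD('p)) * trace V + al * (trace V)\<^sup>2 - (1 + 2 * c0) * trace (V ** V ** Wm X))"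

lemma G_deriv:
  assumes al: "c0 * w X + c1 > 0"
  shows "(G c0 c1 has_derivative G' c0 c1 X) (at X)"
proof -
  let ?M = "\<lambda>X. Wm X + (c0 * w X + c1) *\<^sub>R mat 1"
  have "((\<lambda>X. transpose (Y X)) has_derivative (\<lambda>h. transpose (Y h))) (at X)"
    by (rule bounded_linear.has_derivative[OF bounded_linear_transpose Y_deriv])
  from bounded_linear.has_derivative[OF mm.bounded_linear_left mm.FDERIV[OF Y_deriv this]]
  have W: "(Wm has_derivative (\<lambda>h. (Y X ** transpose (Y h) + Y h ** transpose (Y X)) ** P)) (at X)"
    unfolding Wm_def [abs_def] .
  have "((\<lambda>X. (c0 * w X + c1) *\<^sub>R (mat 1 :: real^'p^'p)) has_derivative
      (\<lambda>h. (c0 * (2 * ((P ** Y X) \<bullet> h)) + 0) *\<^sub>R mat 1)) (at X)"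
    by (intro has_derivative_scaleR_left has_derivative_add has_derivative_mult_right w_deriv has_derivative_const)
  from has_derivative_add[OF W this] have M: "(?M has_derivative dM c0 X) (at X)"
    by (rule has_derivative_eq_rhs) (simp add: fun_eq_iff dM_def add.commute mult_ac)
  have "((\<lambda>X. matrix_inv (?M X)) has_derivative
      (\<lambda>h. - (matrix_inv (?M X) ** dM c0 X h ** matrix_inv (?M X)))) (at X)"
    by (rule has_derivative_compose[OF M has_derivative_matrix_inv[OF invertible_M[OF al]]])
  from mm.FDERIV[OF this Y_deriv] show ?thesis
    unfolding G_def [abs_def] V_eq
    by (rule has_derivative_eq_rhs) (simp add: fun_eq_iff G'_def V_eq Let_def mm.minus_left)
qed

text \<open>Varying the outer factor \<open>Y\<close> gives \<open>(n - 1) * trace V\<close>. Inside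
  the inverse, varying the first factor of \<open>Wm\<close> gives
  \<open>trace V * trace (V ** Wm)\<close>, varying the transposed factor gives
  \<open>trace (V ** V ** Wm)\<close>, and varying the ridge statistic gives \<open>2 * c0\<close>
  times the latter; these three enter with a minus sign.\<close>

lemma G_div:
  assumes al: "c0 * w X + c1 > 0"
  shows "(\<Sum>b\<in>Basis. b \<bullet> G' c0 c1 X b) = D c0 c1 X"
proof -
  let ?al = "c0 * w X + c1"
  let ?V = "V ?al X" and ?T = "trace (V ?al X ** V ?al X ** Wm X)"
  have 1: "(\<Sum>b\<in>Basis. b \<bullet> (?V ** Y b)) = trace ?V * (real CARD('n) - 1)"
    using sum_Basis_trace_mult[of ?V "cmat :: real^'n^'n"] by (simp add: trace_cmat matrix_mul_assoc)
  have 2: "(\<Sum>b\<in>Basis. b \<bullet> (?V ** (Y b ** transpose (Y X) ** P) ** ?V ** Y X))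
      = trace ?V * (real CARD('p) - ?al * trace ?V)"
  proof -
    have "(\<Sum>b\<in>Basis. b \<bullet> (?V ** (Y b ** transpose (Y X) ** P) ** ?V ** Y X))
        = (\<Sum>b\<in>Basis. b \<bullet> (?V ** b ** (cmat ** (transpose (Y X) ** P ** ?V ** Y X))))"
      by (simp only: matrix_mul_assoc)
    also have "\<dots> = trace ?V * trace (cmat ** (transpose (Y X) ** P ** ?V ** Y X))"
      by (rule sum_Basis_trace_mult)
    also have "trace (cmat ** (transpose (Y X) ** P ** ?V ** Y X)) = trace ((transpose (Y X) ** P ** ?V ** Y X) ** cmat)"
      by (rule trace_mul_sym)
    also have "\<dots> = trace (transpose (Y X) ** P ** ?V ** Y X)"
      by (simp add: matrix_mul_assoc[of _ X cmat, symmetric] matrix_mul_assoc[of _ "X ** cmat" cmat, symmetric])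
    also have "\<dots> = real CARD('p) - ?al * trace ?V"
      by (simp only: trace_YPVY V_W[OF al])
    finally show ?thesis .
  qed
  have 3: "(\<Sum>b\<in>Basis. b \<bullet> (?V ** (Y X ** transpose (Y b) ** P) ** ?V ** Y X)) = ?T"
  proof -
    have "(\<Sum>b\<in>Basis. b \<bullet> (?V ** (Y X ** transpose (Y b) ** P) ** ?V ** Y X))
        = (\<Sum>b\<in>Basis. b \<bullet> ((?V ** (Y X ** cmat)) ** transpose b ** (P ** (?V ** Y X))))"
      by (simp only: matrix_transpose_mul transpose_cmat matrix_mul_assoc)
    also have "\<dots> = (?V ** (Y X ** cmat)) \<bullet> (P ** (?V ** Y X))"
      by (rule sum_Basis_transpose_mult)
    also have "\<dots> = ?T"
      by (simp add: inner_VY[OF al])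
    finally show ?thesis .
  qed
  have 4: "(\<Sum>b\<in>Basis. b \<bullet> (?V ** ((2 * c0 * ((P ** Y X) \<bullet> b)) *\<^sub>R mat 1) ** ?V ** Y X)) = 2 * c0 * ?T"
  proof -
    have "(\<Sum>b\<in>Basis. b \<bullet> (?V ** ((2 * c0 * ((P ** Y X) \<bullet> b)) *\<^sub>R mat 1) ** ?V ** Y X))
        = (\<Sum>b\<in>Basis. (2 * c0) * (((P ** Y X) \<bullet> b) * ((?V ** ?V ** Y X) \<bullet> b)))"
      by (simp add: mm.scaleR_left mm.scaleR_right inner_commute mult_ac)
    also have "\<dots> = 2 * c0 * ((P ** Y X) \<bullet> (?V ** ?V ** Y X))"
      by (simp only: sum_distrib_left[symmetric] euclidean_inner[symmetric])
    also have "(P ** Y X) \<bullet> (?V ** ?V ** Y X) = ?T"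
      unfolding symP by (rule inner_Y)
    finally show ?thesis .
  qed
  show ?thesis
    unfolding G'_def dM_def Let_def D_def mm.add_left mm.add_right inner_diff_right inner_add_right
      sum_subtractf sum.distrib 1 2 3 4
    by (simp add: algebra_simps power2_eq_square)
qed

section \<open>Growth of the ridge field and removal of its regularization\<close>

lemma norm_G:
  assumes al: "c0 * w X + c1 > 0"
  shows "norm (G c0 c1 X) \<le> K / (c0 * w X + c1) * norm (Y X)"
  unfolding G_def by (rule order_trans[OF norm_matrix_mult_le mult_right_mono[OF norm_V[OF al]]]) simp

definition cn :: real where "cn = norm (cmat :: real^'n^'n)"

text \<open>The constant in the bound of \<open>dM c0 X h\<close> by
  \<open>norm (Y X) * norm h\<close>: two terms from the variation of \<open>Wm\<close>, one from
  that of the ridge statistic.\<close>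

definition dn :: "real \<Rightarrow> real" where
  "dn c0 = 2 * cn * norm P + 2 * c0 * norm P * norm (mat 1 :: real^'p^'p)"

lemma dn_nonneg: "c0 \<ge> 0 \<Longrightarrow> dn c0 \<ge> 0" and cn_nonneg: "cn \<ge> 0"
  by (simp_all add: dn_def cn_def)

text \<open>The ridge statistic stays in the denominators so that the bound serves twice. If it is
  at least \<open>c1\<close>, the growth is quadratic in \<open>X\<close>; if it is at least
  \<open>c0 * w\<close>, then \<open>(norm (Y X))^2 \<le> w / la\<close> makes both terms of order
  \<open>1 / w\<close>.\<close>

lemma norm_G':
  assumes al: "c0 * w X + c1 > 0" and c0: "c0 \<ge> 0"
  shows "norm (G' c0 c1 X h) \<le>
    (K * cn / (c0 * w X + c1) + K\<^sup>2 * dn c0 * (norm (Y X))\<^sup>2 / (c0 * w X + c1)\<^sup>2) * norm h"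
proof -
  let ?al = "c0 * w X + c1"
  let ?V = "V ?al X" and ?y = "norm (Y X)"
  have V: "norm ?V \<le> K / ?al" by (rule norm_V[OF al])
  have Yh: "norm (Y h) \<le> cn * norm h" using norm_Y_le[of h] by (simp add: cn_def)
  have a1: "norm (?V ** Y h) \<le> (K / ?al) * (cn * norm h)"
    using K_nonneg al by (intro order_trans[OF norm_matrix_mult_le] mult_mono V Yh) auto
  have "norm (Y h ** transpose (Y X)) \<le> (cn * norm h) * ?y"
    by (rule order_trans[OF norm_matrix_mult_le]) (auto simp: norm_transpose intro!: mult_right_mono Yh)
  moreover have "norm (Y X ** transpose (Y h)) \<le> ?y * (cn * norm h)"
    by (rule order_trans[OF norm_matrix_mult_le]) (auto simp: norm_transpose intro!: mult_left_mono Yh)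
  ultimately have "norm (Y h ** transpose (Y X) + Y X ** transpose (Y h)) \<le> 2 * cn * ?y * norm h"
    using norm_triangle_ineq[of "Y h ** transpose (Y X)" "Y X ** transpose (Y h)"]
    by (simp add: mult_ac)
  then have n1: "norm ((Y h ** transpose (Y X) + Y X ** transpose (Y h)) ** P) \<le> (2 * cn * ?y * norm h) * norm P"
    by (intro order_trans[OF norm_matrix_mult_le] mult_right_mono) auto
  have "\<bar>(P ** Y X) \<bullet> h\<bar> \<le> (norm P * ?y) * norm h"
    by (rule order_trans[OF Cauchy_Schwarz_ineq2 mult_right_mono[OF norm_matrix_mult_le]]) simp
  then have n2: "norm ((2 * c0 * ((P ** Y X) \<bullet> h)) *\<^sub>R (mat 1 :: real^'p^'p))
      \<le> (2 * c0 * ((norm P * ?y) * norm h)) * norm (mat 1 :: real^'p^'p)"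
    using c0 by (simp add: abs_mult mult_left_mono mult_right_mono)
  have N: "norm (dM c0 X h) \<le> dn c0 * ?y * norm h"
    unfolding dM_def using n1 n2
    by (intro order_trans[OF norm_triangle_ineq]) (simp add: dn_def algebra_simps)
  have "norm (?V ** dM c0 X h ** ?V ** Y X) \<le> (norm ?V * norm (dM c0 X h)) * norm ?V * ?y"
    by (intro order_trans[OF norm_matrix_mult_le] mult_right_mono norm_ge_zero order_refl)
  also have "\<dots> \<le> ((K / ?al) * (dn c0 * ?y * norm h)) * (K / ?al) * ?y"
    using K_nonneg al dn_nonneg[OF c0] by (intro mult_mono mult_right_mono V N mult_nonneg_nonneg) auto
  finally have a2: "norm (?V ** dM c0 X h ** ?V ** Y X) \<le> ((K / ?al) * (dn c0 * ?y * norm h)) * (K / ?al) * ?y" .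
  have "norm (G' c0 c1 X h) \<le> norm (?V ** Y h) + norm (?V ** dM c0 X h ** ?V ** Y X)"
    unfolding G'_def Let_def by (rule norm_triangle_ineq4)
  with a1 a2 show ?thesis
    by (simp add: algebra_simps power2_eq_square)
qed

lemma stein_G:
  assumes c0: "c0 \<ge> 0" and c1: "c1 > 0"
  shows "has_bochner_integral lborel (\<lambda>X. f X * (G c0 c1 X \<bullet> (P ** (X - Th)) - D c0 c1 X)) 0"
proof -
  define C where "C = K * cn / c1 + K\<^sup>2 * dn c0 * cn\<^sup>2 / c1\<^sup>2"
  have al: "c0 * w X + c1 \<ge> c1" for X using c0 by simp
  have al': "c0 * w X + c1 > 0" for X using al[of X] c1 by linarith
  have YX: "norm (Y X) \<le> cn * norm X" for X
    using norm_Y_le[of X] by (simp add: cn_def)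
  note nn = K_nonneg cn_nonneg dn_nonneg[OF c0]
  have Cn: "K * cn / c1 \<le> C" "K * cn / c1 \<ge> 0" "K\<^sup>2 * dn c0 * cn\<^sup>2 / c1\<^sup>2 \<ge> 0"
    using nn c1 by (auto simp: C_def)
  have b1: "norm (G c0 c1 X) \<le> C * (1 + norm X)" for X
  proof -
    have "norm (G c0 c1 X) \<le> K / (c0 * w X + c1) * norm (Y X)"
      by (rule norm_G[OF al'])
    also have "\<dots> \<le> K / c1 * (cn * norm X)"
      using al[of X] al'[of X] c1 nn by (intro mult_mono frac_le YX) auto
    also have "\<dots> = (K * cn / c1) * norm X" by simp
    also have "\<dots> \<le> C * (1 + norm X)"
      using Cn by (intro mult_mono) auto
    finally show ?thesis .
  qed
  have b2: "norm (G' c0 c1 X b) \<le> C * (1 + (norm X)\<^sup>2)" if b: "b \<in> Basis" for X b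
  proof -
    have "norm (G' c0 c1 X b) \<le> K * cn / (c0 * w X + c1) + K\<^sup>2 * dn c0 * (norm (Y X))\<^sup>2 / (c0 * w X + c1)\<^sup>2"
      using norm_G'[OF al' c0, of X b] b by simp
    also have "\<dots> \<le> K * cn / c1 + K\<^sup>2 * dn c0 * (cn * norm X)\<^sup>2 / c1\<^sup>2"
      using al[of X] al'[of X] c1 nn by (intro add_mono frac_le mult_left_mono power_mono YX) auto
    also have "\<dots> = (K * cn / c1) * 1 + (K\<^sup>2 * dn c0 * cn\<^sup>2 / c1\<^sup>2) * (norm X)\<^sup>2"
      by (simp add: power_mult_distrib)
    also have "\<dots> \<le> (K * cn / c1) * (1 + (norm X)\<^sup>2) + (K\<^sup>2 * dn c0 * cn\<^sup>2 / c1\<^sup>2) * (1 + (norm X)\<^sup>2)"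
      using Cn by (intro add_mono mult_left_mono) auto
    finally show ?thesis by (simp add: C_def distrib_right)
  qed
  show ?thesis
    using stein[OF G_deriv[OF al'] b1 b2] unfolding G_div[OF al']
    by (simp add: has_bochner_integral_iff right_diff_distrib)
qed

text \<open>On \<open>w = 0\<close> with \<open>c1 = 0\<close> the ridge matrix is zero and its
  inverse unspecified. The indicator removes this null set, so that the regularized integrands
  converge at every point and the limit is measurable.\<close>

lemma stein_G_limit:
  assumes c0: "c0 > 0" and int: "integrable lborel (\<lambda>X. f X / w X)"
  shows "has_bochner_integral lborel
    (\<lambda>X. indicator {X. w X \<noteq> 0} X * (f X * (G c0 0 X \<bullet> (P ** (X - Th)) - D c0 0 X))) 0"
proof -
  let ?q = "\<lambda>X. (X - Th) \<bullet> (P ** (X - Th))"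
  let ?e = "\<lambda>k. 1 / real (Suc k)"
  let ?U = "{X. w X \<noteq> 0}"
  let ?s = "\<lambda>e X. f X * (G c0 e X \<bullet> (P ** (X - Th)) - D c0 e X)"
  define N where "N = real (card (Basis :: (real^'n^'p) set))"
  \<comment> \<open>The first summand comes from Young's inequality applied to the form of
    \<open>G\<close>; the second bounds the divergence by \<open>N\<close> diagonal entries of the
    derivative, each of order \<open>1 / w\<close>.\<close>
  define C where "C = norm P * (K / c0)\<^sup>2 / la / 2 + N * (K * cn / c0 + K\<^sup>2 * dn c0 / (la * c0\<^sup>2))"
  have lim: "(\<lambda>k. ?s (?e k) X) \<longlonglongrightarrow> ?s 0 X" if nz: "w X \<noteq> 0" for X
  proof -
    have p: "c0 * w X + 0 > 0" using nz c0 w_nonneg[of X] by (simp add: less_le)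
    have "isCont matrix_inv (Wm X + (c0 * w X + 0) *\<^sub>R mat 1)"
      by (rule has_derivative_continuous[OF has_derivative_matrix_inv[OF invertible_M[OF p]]])
    moreover have "(\<lambda>k. Wm X + (c0 * w X + ?e k) *\<^sub>R mat 1) \<longlonglongrightarrow> Wm X + (c0 * w X + 0) *\<^sub>R mat 1"
      by (intro tendsto_intros LIMSEQ_Suc[OF lim_1_over_n])
    ultimately have V: "(\<lambda>k. V (c0 * w X + ?e k) X) \<longlonglongrightarrow> V (c0 * w X + 0) X"
      unfolding V_eq by (rule isCont_tendsto_compose)
    have "(\<lambda>k. G c0 (?e k) X) \<longlonglongrightarrow> G c0 0 X"
      unfolding G_def by (intro mm.tendsto V tendsto_const)
    moreover have "(\<lambda>k. D c0 (?e k) X) \<longlonglongrightarrow> D c0 0 X"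
      unfolding D_def Let_def
      by (intro tendsto_intros bounded_linear.tendsto[OF bounded_linear_trace] mm.tendsto V LIMSEQ_Suc[OF lim_1_over_n])
    ultimately show ?thesis
      by (intro tendsto_intros)
  qed
  have lim': "(\<lambda>k. indicator ?U X * ?s (?e k) X) \<longlonglongrightarrow> indicator ?U X * ?s 0 X" for X
    using lim[of X] by (cases "w X = 0") auto
  have meas: "(\<lambda>X. indicator ?U X * ?s (?e k) X) \<in> borel_measurable lborel" for k
  proof -
    have [measurable]: "?s (?e k) \<in> borel_measurable borel"
      using stein_G[of c0 "?e k"] c0 by (auto simp: has_bochner_integral_iff dest: borel_measurable_integrable)
    show ?thesis by measurable
  qed
  show ?thesis
  proof (rule has_bochner_integral_dominated_limit)
    show "(\<lambda>X. indicator ?U X * ?s 0 X) \<in> borel_measurable lborel"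
      by (rule borel_measurable_LIMSEQ_real[OF lim' meas])
    show "(\<lambda>X. indicator ?U X * ?s (?e k) X) \<in> borel_measurable lborel" for k
      by (rule meas)
    show "integrable lborel (\<lambda>X. C * (f X / w X) + f X * ?q X)"
      by (intro Bochner_Integration.integrable_add Bochner_Integration.integrable_mult_right int integrable_qf)
    show "AE X in lborel. (\<lambda>k. indicator ?U X * ?s (?e k) X) \<longlonglongrightarrow> indicator ?U X * ?s 0 X"
      by (intro AE_I2 lim')
    show "integral\<^sup>L lborel (\<lambda>X. indicator ?U X * ?s (?e k) X) = 0" for k
    proof -
      have "integral\<^sup>L lborel (\<lambda>X. indicator ?U X * ?s (?e k) X) = integral\<^sup>L lborel (?s (?e k))"
      proof (rule integral_cong_AE[OF meas])
        show "?s (?e k) \<in> borel_measurable lborel"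
          using stein_G[of c0 "?e k"] c0 by (auto simp: has_bochner_integral_iff dest: borel_measurable_integrable)
        show "AE X in lborel. indicator ?U X * ?s (?e k) X = ?s (?e k) X"
          using AE_w_nonzero by eventually_elim simp
      qed
      also have "\<dots> = 0"
        using stein_G[of c0 "?e k"] c0 by (auto simp: has_bochner_integral_iff)
      finally show ?thesis .
    qed
    show "AE X in lborel. norm (indicator ?U X * ?s (?e k) X) \<le> C * (f X / w X) + f X * ?q X" for k
      using AE_w_nonzero
    proof eventually_elim
      fix X assume nz: "w X \<noteq> 0"
      then have p: "w X > 0" using w_nonneg[of X] by linarith
      define e where "e = ?e k"
      have e: "e > 0" by (simp add: e_def)
      have al: "c0 * w X \<le> c0 * w X + e" "c0 * w X > 0" "c0 * w X + e > 0"
        using c0 p e by (auto simp: add_pos_pos)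
      have q: "?q X \<ge> 0"
        by (rule qf_nonneg)
      have y: "(norm (Y X))\<^sup>2 \<le> w X / la"
        using w_lower[of X] la by (simp add: field_simps)
      note nn = K_nonneg cn_nonneg dn_nonneg[of c0]
      have "G c0 e X \<bullet> (P ** G c0 e X) \<le> norm (G c0 e X) * (norm P * norm (G c0 e X))"
        by (rule order_trans[OF norm_cauchy_schwarz mult_left_mono[OF norm_matrix_mult_le]]) simp
      also have "\<dots> = norm P * (norm (G c0 e X))\<^sup>2"
        by (simp add: power2_eq_square)
      also have "\<dots> \<le> norm P * (K / (c0 * w X) * norm (Y X))\<^sup>2"
      proof (intro mult_left_mono power_mono)
        have "norm (G c0 e X) \<le> K / (c0 * w X + e) * norm (Y X)"
          by (rule norm_G[OF al(3)])
        also have "\<dots> \<le> K / (c0 * w X) * norm (Y X)"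
          using nn al by (intro mult_right_mono frac_le) auto
        finally show "norm (G c0 e X) \<le> K / (c0 * w X) * norm (Y X)" .
      qed auto
      also have "\<dots> = norm P * (K / (c0 * w X))\<^sup>2 * (norm (Y X))\<^sup>2"
        by (simp only: power_mult_distrib mult.assoc)
      also have "\<dots> \<le> norm P * (K / (c0 * w X))\<^sup>2 * (w X / la)"
        using y by (intro mult_left_mono) auto
      also have "\<dots> = norm P * (K / c0)\<^sup>2 / la * (1 / w X)"
        using p by (simp add: power2_eq_square field_simps)
      finally have qG: "G c0 e X \<bullet> (P ** G c0 e X) \<le> norm P * (K / c0)\<^sup>2 / la * (1 / w X)" .
      have 1: "\<bar>G c0 e X \<bullet> (P ** (X - Th))\<bar> \<le> norm P * (K / c0)\<^sup>2 / la / 2 * (1 / w X) + ?q X"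
      proof -
        have "\<bar>x\<bar> \<le> A / 2 + t" if "\<bar>x\<bar> \<le> (a + t) / 2" "a \<le> A" "0 \<le> t" for x a A t :: real
          using that by simp
        from this[OF young qG q] show ?thesis
          by simp
      qed
      have "\<bar>D c0 e X\<bar> \<le> (\<Sum>b\<in>Basis. \<bar>b \<bullet> G' c0 e X b\<bar>)"
        unfolding G_div[OF al(3), symmetric] by (rule sum_abs)
      also have "\<dots> \<le> (\<Sum>b\<in>(Basis :: (real^'n^'p) set). (K * cn / c0 + K\<^sup>2 * dn c0 / (la * c0\<^sup>2)) * (1 / w X))"
      proof (rule sum_mono)
        fix b :: "real^'n^'p" assume b: "b \<in> Basis"
        have "\<bar>b \<bullet> G' c0 e X b\<bar> \<le> norm (G' c0 e X b)"
          using Basis_le_norm[OF b] by (simp add: inner_commute[of b])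
        also have "\<dots> \<le> K * cn / (c0 * w X + e) + K\<^sup>2 * dn c0 * (norm (Y X))\<^sup>2 / (c0 * w X + e)\<^sup>2"
          using norm_G'[OF al(3), of b] b c0 by simp
        also have "\<dots> \<le> K * cn / (c0 * w X) + K\<^sup>2 * dn c0 * (w X / la) / (c0 * w X)\<^sup>2"
          using al nn y c0 la p by (intro add_mono frac_le mult_left_mono power_mono) auto
        also have "\<dots> = (K * cn / c0 + K\<^sup>2 * dn c0 / (la * c0\<^sup>2)) * (1 / w X)"
          using p c0 la by (simp add: power2_eq_square field_simps)
        finally show "\<bar>b \<bullet> G' c0 e X b\<bar> \<le> (K * cn / c0 + K\<^sup>2 * dn c0 / (la * c0\<^sup>2)) * (1 / w X)" .
      qed
      also have "\<dots> = N * (K * cn / c0 + K\<^sup>2 * dn c0 / (la * c0\<^sup>2)) * (1 / w X)"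
        by (simp add: N_def)
      finally have 2: "\<bar>D c0 e X\<bar> \<le> N * (K * cn / c0 + K\<^sup>2 * dn c0 / (la * c0\<^sup>2)) * (1 / w X)" .
      have "\<bar>G c0 e X \<bullet> (P ** (X - Th)) - D c0 e X\<bar> \<le> C * (1 / w X) + ?q X"
        using 1 2 unfolding C_def distrib_right by linarith
      from mult_left_mono[OF this, of "f X"]
      have "f X * \<bar>G c0 e X \<bullet> (P ** (X - Th)) - D c0 e X\<bar> \<le> f X * (C * (1 / w X) + ?q X)"
        by simp
      also have "\<dots> = C * (f X / w X) + f X * ?q X"
        by (simp add: algebra_simps)
      finally show "norm (indicator ?U X * ?s (?e k) X) \<le> C * (f X / w X) + f X * ?q X"
        unfolding e_def real_norm_def abs_mult using nz by simp
    qed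
  qed
qed

subsection \<open>The risk difference\<close>

lemma qf_add: "qf (u + v) = qf u + 2 * (u \<bullet> (P ** v)) + qf v"
  using symP[of v u] by (simp add: mm.add_right inner_add_left inner_add_right inner_commute)

lemma qf_diff: "qf (u - v) = qf u - 2 * (v \<bullet> (P ** u)) + qf v"
  using symP[of v u] by (simp add: mm.diff_right inner_diff_left inner_diff_right inner_commute)

lemma qf_scaleR: "qf (c *\<^sub>R u) = c\<^sup>2 * qf u"
  by (simp add: mm.scaleR_right power2_eq_square)

lemma qf_F0: "qf (F 0 X) = 1 / w X"
  by (simp add: F_qf power2_eq_square)

text \<open>Fewer than three degrees of freedom leave only \<open>p = 1\<close> or \<open>n = 2\<close>.\<close>

lemma rank_one:
  assumes "m < 3"
  shows "Wm X ** Y X = w X *\<^sub>R Y X"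
proof -
  have "CARD('p) = 1 \<or> CARD('n) = 2"
  proof (rule ccontr)
    assume "\<not> ?thesis"
    moreover have "CARD('p) \<ge> 1"
      by (simp add: Suc_leI)
    ultimately have "CARD('p) \<ge> 2" "CARD('n) \<ge> 3"
      using n2 by linarith+
    then have "2 * (3 - 1) \<le> m"
      unfolding m_def by (intro mult_mono) auto
    then show False
      using assms by simp
  qed
  then show ?thesis
  proof
    assume "CARD('p) = 1"
    then obtain i0 :: 'p where U: "UNIV = {i0}"
      by (rule card_1_singletonE)
    then have i0: "i = i0" for i :: 'p
      by (metis UNIV_I singletonD)
    have "w X = Wm X $ i0 $ i0"
      using trace_Wm[of X] by (simp add: trace_def U)
    \<comment> \<open>A matrix with a single entry equals its trace times the identity.\<close>
    then have "Wm X = w X *\<^sub>R mat 1"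
      by (simp add: vec_eq_iff mat_def) (metis i0)
    then show ?thesis
      by (simp add: mm.scaleR_left)
  next
    assume "CARD('n) = 2"
    then obtain j0 j1 :: 'n where U: "UNIV = {j0, j1}" and ne: "j0 \<noteq> j1"
      by (meson card_2_iff)
    have sum2: "sum h (UNIV :: 'n set) = h j0 + h j1" for h :: "'n \<Rightarrow> real"
      using ne by (simp add: U)
    have cases: "j = j0 \<or> j = j1" for j
      using U by auto
    define B where "B = transpose X ** P ** X"
    have c: "cmat $ i $ j = (if i = j then 1/2 else - 1/2 :: real)" for i j :: 'n
      by (simp add: cmat_def \<open>CARD('n) = 2\<close>)
    \<comment> \<open>For two columns the centring projection has rank one, spanned by
      \<open>(1, -1)\<close>, so compressing any matrix by it gives a multiple of it.\<close>
    have CBC: "cmat ** B ** cmat = trace (cmat ** B) *\<^sub>R cmat"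
      unfolding vec_eq_iff
    proof (intro allI)
      fix i j
      show "(cmat ** B ** cmat) $ i $ j = (trace (cmat ** B) *\<^sub>R cmat) $ i $ j"
        using cases[of i] cases[of j] ne
        by (auto simp: matrix_matrix_mult_def trace_def sum2 c field_simps)
    qed
    let ?t = "trace (cmat ** B)"
    have YPY: "transpose (Y X) ** P ** Y X = cmat ** B ** cmat"
      by (simp add: B_def matrix_transpose_mul matrix_mul_assoc)
    have "w X = trace (transpose (Y X) ** P ** Y X)"
      by (simp add: w_def inner_mat_trace matrix_mul_assoc)
    also have "\<dots> = ?t"
      unfolding YPY CBC by (simp add: trace_scaleR trace_cmat \<open>CARD('n) = 2\<close>)
    finally have w: "w X = ?t" .
    have "Wm X ** Y X = Y X ** (transpose (Y X) ** P ** Y X)"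
      by (simp add: Wm_def matrix_mul_assoc)
    also have "\<dots> = ?t *\<^sub>R Y X"
      unfolding YPY CBC by (simp add: mm.scaleR_right)
    finally show ?thesis
      by (simp add: w)
  qed
qed

text \<open>On \<open>Y\<close> the ridge matrix acts as the scalar \<open>w * (1 + c)\<close>, so
  its inverse acts as the reciprocal; where \<open>w\<close> vanishes, both sides are 0 with
  \<open>Y\<close>.\<close>

lemma G_rank_one:
  assumes m: "m < 3" and c: "c > 0"
  shows "G c 0 X = (1 / (1 + c)) *\<^sub>R F 0 X"
proof (cases "w X = 0")
  case True
  then show ?thesis
    by (simp add: G_def F_def w_eq_0_iff)
next
  case False
  then have p: "c * w X > 0"
    using c w_nonneg[of X] by (simp add: less_le)
  let ?V = "V (c * w X) X"
  have "?V ** ((Wm X + (c * w X) *\<^sub>R mat 1) ** Y X) = Y X"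
    by (simp add: V_eq matrix_mul_assoc matrix_inv_mult[OF invertible_M[OF p]])
  moreover have "(Wm X + (c * w X) *\<^sub>R mat 1) ** Y X = (w X * (1 + c)) *\<^sub>R Y X"
    using rank_one[OF m, of X]
    by (simp add: mm.add_left mm.scaleR_left distrib_left distrib_right scaleR_add_left mult.commute)
  ultimately have "(w X * (1 + c)) *\<^sub>R (?V ** Y X) = Y X"
    by (simp add: mm.scaleR_right)
  then have "(1 / (w X * (1 + c))) *\<^sub>R ((w X * (1 + c)) *\<^sub>R (?V ** Y X)) = (1 / (w X * (1 + c))) *\<^sub>R Y X"
    by simp
  then have "?V ** Y X = (1 / (w X * (1 + c))) *\<^sub>R Y X"
    using False c by simp
  then show ?thesis
    by (simp add: G_def F_def mult.commute)
qed

text \<open>The fields in \<open>G_rank_one\<close> agree everywhere, so uniqueness of the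
  derivative transfers the divergence of \<open>F 0\<close> without evaluating the traces in
  \<open>D\<close>.\<close>

lemma D_rank_one:
  assumes m: "m < 3" and c: "c > 0" and nz: "w X \<noteq> 0"
  shows "D c 0 X = (1 / (1 + c)) * ((m - 2) / w X)"
proof -
  have p: "c * w X + 0 > 0"
    using c nz w_nonneg[of X] by (simp add: less_le)
  have "G c 0 = (\<lambda>X. (1 / (1 + c)) *\<^sub>R F 0 X)"
    by (intro ext G_rank_one[OF m c])
  then have "(G c 0 has_derivative (\<lambda>h. (1 / (1 + c)) *\<^sub>R F' 0 X h)) (at X)"
    using has_derivative_scaleR_right[OF F_deriv[of X 0], of "1 / (1 + c)"] nz by simp
  then have "G' c 0 X = (\<lambda>h. (1 / (1 + c)) *\<^sub>R F' 0 X h)"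
    by (rule has_derivative_unique[OF G_deriv[OF p]])
  then have "D c 0 X = (1 / (1 + c)) * (\<Sum>b\<in>Basis. b \<bullet> F' 0 X b)"
    using G_div[OF p] by (simp add: sum_divide_distrib)
  also have "(\<Sum>b\<in>Basis. b \<bullet> F' 0 X b) = (m - 2) / w X"
    unfolding F_div using nz by (simp add: power2_eq_square diff_divide_distrib)
  finally show ?thesis .
qed

text \<open>If \<open>f / w\<close> is not integrable, integrability of the loss of \<open>X - (a * G + b * F)\<close>
  forces the singular part of the shrinkage term to cancel.\<close>

lemma stein_combined:
  fixes a b c c0 c1 :: real
  defines "g \<equiv> \<lambda>X. a *\<^sub>R G c0 c1 X + b *\<^sub>R F 0 X"
  assumes c: "c > 0" and ridge: "(c0 = 0 \<and> c1 = c) \<or> (c0 = c \<and> c1 = 0)"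
    and int: "integrable lborel (\<lambda>X. f X * qf (X - g X - Th))"
  shows "has_bochner_integral lborel
    (\<lambda>X. indicator {X. w X \<noteq> 0} X * (2 * f X * (g X \<bullet> (P ** (X - Th)) - (a * D c0 c1 X + b * ((m - 2) / w X))))) 0"
proof -
  let ?U = "{X. w X \<noteq> 0}"
  let ?RG = "\<lambda>X. f X * (G c0 c1 X \<bullet> (P ** (X - Th)) - D c0 c1 X)"
  let ?RF = "\<lambda>X. f X * (F 0 X \<bullet> (P ** (X - Th)) - (m - 2) / w X)"
  have split: "indicator ?U X * (2 * f X * (g X \<bullet> (P ** (X - Th)) - (a * D c0 c1 X + b * ((m - 2) / w X))))
      = (2 * a) * (indicator ?U X * ?RG X) + (2 * b) * ?RF X" for X
    by (cases "w X = 0") (auto simp: g_def inner_add_left algebra_simps F_def w_eq_0_iff)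
  have RG: "has_bochner_integral lborel (\<lambda>X. indicator ?U X * ?RG X) 0" if "c0 = 0" "c1 = c"
  proof -
    have *: "has_bochner_integral lborel ?RG 0"
      using stein_G[of c0 c1] that c by simp
    then have [measurable]: "?RG \<in> borel_measurable borel"
      by (auto simp: has_bochner_integral_iff)
    show ?thesis
    proof (rule has_bochner_integralI_AE[OF *])
      show "AE X in lborel. ?RG X = indicator ?U X * ?RG X"
        using AE_w_nonzero by eventually_elim simp
    qed measurable
  qed
  show ?thesis
  proof (cases "integrable lborel (\<lambda>X. f X / w X)")
    case True
    have "has_bochner_integral lborel (\<lambda>X. indicator ?U X * ?RG X) 0"
      using ridge RG stein_G_limit[OF c True] by auto
    then have "has_bochner_integral lborel
        (\<lambda>X. (2 * a) * (indicator ?U X * ?RG X) + (2 * b) * ?RF X) ((2 * a) * 0 + (2 * b) * 0)"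
      by (intro has_bochner_integral_add has_bochner_integral_mult_right stein_F_limit[OF True])
    then show ?thesis
      unfolding split by simp
  next
    case False
    then have m3: "m < 3"
      using hardy by force
    \<comment> \<open>Young's inequality with the scalings 1/2 and 2 bounds twice the cross term by
      \<open>qf (g X) / 4 + 4 * qf (X - Th)\<close>, which leaves three quarters of
      \<open>qf (g X)\<close> under the control of the loss.\<close>
    have qg: "qf (g X) \<le> 2 * \<bar>qf (X - g X - Th)\<bar> + 4 * qf (X - Th)" for X
    proof -
      have "qf (X - g X - Th) = qf ((X - Th) - g X)"
        by (simp add: algebra_simps)
      also have "\<dots> = qf (X - Th) - 2 * (g X \<bullet> (P ** (X - Th))) + qf (g X)"
        by (rule qf_diff)
      finally have 1: "qf (X - g X - Th) = qf (X - Th) - 2 * (g X \<bullet> (P ** (X - Th))) + qf (g X)" .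
      have "g X \<bullet> (P ** (X - Th)) = ((1/2) *\<^sub>R g X) \<bullet> (P ** (2 *\<^sub>R (X - Th)))"
        by (simp add: mm.scaleR_right)
      also have "\<dots> \<le> (qf ((1/2) *\<^sub>R g X) + qf (2 *\<^sub>R (X - Th))) / 2"
        using young[of "(1/2) *\<^sub>R g X" "2 *\<^sub>R (X - Th)"] by linarith
      also have "\<dots> = qf (g X) / 8 + 2 * qf (X - Th)"
        unfolding qf_scaleR by (simp add: power2_eq_square field_simps)
      finally have 2: "g X \<bullet> (P ** (X - Th)) \<le> qf (g X) / 8 + 2 * qf (X - Th)" .
      show ?thesis
        using 1 2 qf_nonneg[of "g X"] qf_nonneg[of "X - Th"] by argo
    qed
    have intb: "integrable lborel (\<lambda>X. 2 * \<bar>f X * qf (X - g X - Th)\<bar> + 4 * (f X * qf (X - Th)))"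
      by (intro Bochner_Integration.integrable_add Bochner_Integration.integrable_mult_right
          integrable_abs int integrable_qf)
    have qg': "f X * qf (g X) \<le> 2 * \<bar>f X * qf (X - g X - Th)\<bar> + 4 * (f X * qf (X - Th))" for X
      using mult_left_mono[OF qg[of X], of "f X"] by (simp add: abs_mult distrib_left mult.left_commute)
    from ridge show ?thesis
    proof
      assume r: "c0 = 0 \<and> c1 = c"
      \<comment> \<open>With a constant ridge, \<open>G\<close> has linear growth and its form is
        integrable against \<open>f\<close>. Subtracting \<open>a G\<close> from \<open>g\<close>
        thus isolates \<open>b F 0\<close>, whose form is \<open>b^2 / w\<close>.\<close>
      have "b = 0"
      proof (rule ccontr)
        assume b: "b \<noteq> 0"
        define L where "L = norm P * (K / c * cn)\<^sup>2"
        have qG: "qf (G c0 c1 X) \<le> L * (1 + (norm X)\<^sup>2)" for X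
        proof -
          have "qf (G c0 c1 X) \<le> norm (G c0 c1 X) * (norm P * norm (G c0 c1 X))"
            by (rule order_trans[OF norm_cauchy_schwarz mult_left_mono[OF norm_matrix_mult_le]]) simp
          also have "\<dots> = norm P * (norm (G c0 c1 X))\<^sup>2"
            by (simp add: power2_eq_square)
          also have "\<dots> \<le> norm P * (K / c * (cn * norm X))\<^sup>2"
          proof (intro mult_left_mono power_mono)
            have "norm (G c0 c1 X) \<le> K / c * norm (Y X)"
              using norm_G[of c0 X c1] r c by simp
            also have "\<dots> \<le> K / c * (cn * norm X)"
              using norm_Y_le[of X] K_nonneg c by (intro mult_left_mono) (auto simp: cn_def)
            finally show "norm (G c0 c1 X) \<le> K / c * (cn * norm X)" .
          qed auto
          also have "\<dots> = L * (norm X)\<^sup>2"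
            unfolding L_def by (simp only: power_mult_distrib mult.assoc)
          also have "\<dots> \<le> L * (1 + (norm X)\<^sup>2)"
            by (intro mult_left_mono) (auto simp: L_def)
          finally show ?thesis .
        qed
        have "integrable lborel (\<lambda>X. f X / w X)"
        proof (rule Bochner_Integration.integrable_bound)
          show "integrable lborel (\<lambda>X. (1 / b\<^sup>2) * (2 * (2 * \<bar>f X * qf (X - g X - Th)\<bar> + 4 * (f X * qf (X - Th)))
              + (2 * a\<^sup>2 * L) * (f X * (1 + (norm X)\<^sup>2))))"
            by (intro Bochner_Integration.integrable_add Bochner_Integration.integrable_mult_right intb integrable_poly)
          show "AE X in lborel. norm (f X / w X) \<le> norm ((1 / b\<^sup>2) * (2 * (2 * \<bar>f X * qf (X - g X - Th)\<bar> + 4 * (f X * qf (X - Th)))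
              + (2 * a\<^sup>2 * L) * (f X * (1 + (norm X)\<^sup>2))))"
          proof (rule AE_I2)
            fix X
            have "b\<^sup>2 * (1 / w X) = qf (g X + (- a) *\<^sub>R G c0 c1 X)"
            proof -
              have "g X + (- a) *\<^sub>R G c0 c1 X = b *\<^sub>R F 0 X"
                by (simp add: g_def)
              then show ?thesis
                by (simp only: qf_scaleR qf_F0)
            qed
            also have "\<dots> \<le> 2 * qf (g X) + 2 * qf ((- a) *\<^sub>R G c0 c1 X)"
              unfolding qf_add using abs_le_D1[OF young[of "g X" "(- a) *\<^sub>R G c0 c1 X"]] by argo
            also have "qf ((- a) *\<^sub>R G c0 c1 X) = a\<^sup>2 * qf (G c0 c1 X)"
              unfolding qf_scaleR by simp
            also have "a\<^sup>2 * qf (G c0 c1 X) \<le> a\<^sup>2 * (L * (1 + (norm X)\<^sup>2))"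
              by (intro mult_left_mono qG) simp
            finally have "b\<^sup>2 * (1 / w X) \<le> 2 * qf (g X) + 2 * (a\<^sup>2 * (L * (1 + (norm X)\<^sup>2)))"
              by simp
            from mult_left_mono[OF this, of "f X"]
            have "b\<^sup>2 * (f X / w X) \<le> 2 * (f X * qf (g X)) + (2 * a\<^sup>2 * L) * (f X * (1 + (norm X)\<^sup>2))"
              by (simp add: algebra_simps)
            also have "\<dots> \<le> 2 * (2 * \<bar>f X * qf (X - g X - Th)\<bar> + 4 * (f X * qf (X - Th)))
                + (2 * a\<^sup>2 * L) * (f X * (1 + (norm X)\<^sup>2))"
              using qg'[of X] by simp
            finally show "norm (f X / w X) \<le> norm ((1 / b\<^sup>2) * (2 * (2 * \<bar>f X * qf (X - g X - Th)\<bar> + 4 * (f X * qf (X - Th)))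
                + (2 * a\<^sup>2 * L) * (f X * (1 + (norm X)\<^sup>2))))"
              by (rule norm_le_norm_if_scaled_le[OF b, rotated]) simp
          qed
        qed simp
        with False show False by simp
      qed
      moreover have "has_bochner_integral lborel (\<lambda>X. (2 * a) * (indicator ?U X * ?RG X)) ((2 * a) * 0)"
        using r by (intro has_bochner_integral_mult_right RG) auto
      ultimately show ?thesis
        unfolding split by simp
    next
      assume r: "c0 = c \<and> c1 = 0"
      \<comment> \<open>In this case \<open>G\<close> and \<open>F 0\<close> are proportional;
        \<open>d\<close> is the total coefficient of the singular field in \<open>g\<close>.\<close>
      define d where "d = a / (1 + c) + b"
      have g: "g X = d *\<^sub>R F 0 X" for X
        using r by (simp add: g_def G_rank_one[OF m3 c] d_def scaleR_add_left)
      have "d = 0"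
      proof (rule ccontr)
        assume d: "d \<noteq> 0"
        have "integrable lborel (\<lambda>X. f X / w X)"
        proof (rule Bochner_Integration.integrable_bound)
          show "integrable lborel (\<lambda>X. (1 / d\<^sup>2) * (2 * \<bar>f X * qf (X - g X - Th)\<bar> + 4 * (f X * qf (X - Th))))"
            by (intro Bochner_Integration.integrable_mult_right intb)
          show "AE X in lborel. norm (f X / w X) \<le> norm ((1 / d\<^sup>2) * (2 * \<bar>f X * qf (X - g X - Th)\<bar> + 4 * (f X * qf (X - Th))))"
          proof (rule AE_I2)
            fix X
            have "d\<^sup>2 * (f X / w X) = f X * qf (g X)"
              unfolding g qf_scaleR qf_F0 by simp
            also note qg'[of X]
            finally show "norm (f X / w X) \<le> norm ((1 / d\<^sup>2) * (2 * \<bar>f X * qf (X - g X - Th)\<bar> + 4 * (f X * qf (X - Th))))"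
              by (rule norm_le_norm_if_scaled_le[OF d, rotated]) simp
          qed
        qed simp
        with False show False by simp
      qed
      \<comment> \<open>The divergence carries the same coefficient \<open>d\<close> as the field,
        so both cancel together and the integrand is identically 0.\<close>
      have "a * D c0 c1 X + b * ((m - 2) / w X) = d * ((m - 2) / w X)" if "w X \<noteq> 0" for X
      proof -
        have "a * (1 / (1 + c) * t) + b * t = (a / (1 + c) + b) * t" for t
          by (simp add: distrib_right)
        moreover have "D c0 c1 X = 1 / (1 + c) * ((m - 2) / w X)"
          using r D_rank_one[OF m3 c that] by simp
        ultimately show ?thesis
          by (simp only: d_def)
      qed
      then have "indicator ?U X * (2 * f X * (g X \<bullet> (P ** (X - Th)) - (a * D c0 c1 X + b * ((m - 2) / w X)))) = 0" for X
        using \<open>d = 0\<close> by (cases "w X = 0") (auto simp: g)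
      then show ?thesis
        by (simp only: has_bochner_integral_zero)
    qed
  qed
qed

end

text \<open>The Bochner integral of a function that is not integrable is 0 by convention, so the two
  integrability hypotheses make the expectations on both sides genuine; the loss of \<open>X\<close>
  itself is always integrable.\<close>

theorem theorem1:
  fixes Sigma :: "real^'p^'p" and Theta :: "real^'n^'p"
    and alpha :: "real^'p^'p \<Rightarrow> real" and a b c c0 :: real
  assumes n2: "CARD('n) \<ge> 2"
    and Spd: "pos_def_mat Sigma"
    and c_pos: "c > 0"
    and ridge: "(alpha = (\<lambda>W. c) \<and> c0 = 0) \<or> (alpha = (\<lambda>W. c * trace W) \<and> c0 = c)"
    and int_Delta: "integrable (matnormal Theta Sigma) (Delta_hat alpha c0 a b Sigma)"
    and int_loss: "integrable (matnormal Theta Sigma) (\<lambda>X. loss Sigma Theta (RLS alpha a b Sigma X))"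
  shows "(\<integral>X. Delta_hat alpha c0 a b Sigma X \<partial>(matnormal Theta Sigma)) =
         real CARD('n) * real CARD('p) *
           (risk Sigma Theta (RLS alpha a b Sigma) - risk Sigma Theta (\<lambda>X. X))"
proof -
  define P where "P = matrix_inv Sigma"
  have P: "pos_def_mat P"
    unfolding P_def by (rule pos_def_inv(2)[OF Spd])
  obtain l1 where l1: "l1 > 0" "\<And>Z :: real^'n^'p. l1 * (norm Z)\<^sup>2 \<le> Z \<bullet> (P ** Z)"
    by (rule pos_def_coercive[OF P, where 'n = 'n]) blast
  obtain l2 where l2: "l2 > 0" "\<And>Z :: real^'p^'p. l2 * (norm Z)\<^sup>2 \<le> Z \<bullet> (P ** Z)"
    by (rule pos_def_coercive[OF P, where 'n = 'p]) blast
  interpret centred_gaussian P "min l1 l2" Theta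
  proof
    show "transpose P = P"
      using P by (simp add: pos_def_mat_def)
    show "min l1 l2 > 0"
      using l1 l2 by simp
    show "min l1 l2 * (norm Z)\<^sup>2 \<le> Z \<bullet> (P ** Z)" for Z :: "real^'n^'p"
      by (rule order_trans[OF mult_right_mono l1(2)]) auto
    show "min l1 l2 * (norm Z)\<^sup>2 \<le> Z \<bullet> (P ** Z)" for Z :: "real^'p^'p"
      by (rule order_trans[OF mult_right_mono l2(2)]) auto
  qed (rule n2)
  define k where "k = ((2 * pi) powr (- real CARD('p) / 2) * det Sigma powr (- 1 / 2)) ^ CARD('n)"
  \<comment> \<open>\<open>powr\<close> is positive at every nonzero base, so a nonzero determinant
    suffices for the positivity of \<open>k\<close>.\<close>
  have "det Sigma \<noteq> 0"
    using pos_def_inv(1)[OF Spd] by (simp add: invertible_det_nz)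
  then have k: "k > 0"
    by (simp add: k_def)
  have mn: "matnormal Theta Sigma = density lborel (\<lambda>X. ennreal (k * f X))"
    unfolding matnormal_def matnormal_density_eq k_def P_def ..
  have mn_int: "integrable (matnormal Theta Sigma) h \<longleftrightarrow> integrable lborel (\<lambda>X. f X * h X)"
    and mn_integral: "(\<integral>X. h X \<partial>matnormal Theta Sigma) = k * (\<integral>X. f X * h X \<partial>lborel)"
    if "h \<in> borel_measurable borel" for h :: "real^'n^'p \<Rightarrow> real"
    using that k unfolding mn
    by (subst integrable_density integral_density; simp add: mult.assoc)+
  \<comment> \<open>Both ridge statistics take the form \<open>c0 * w + c1\<close>: the constant one
    has \<open>c1 = c\<close>, the multiple of the trace has \<open>c1 = 0\<close>.\<close>
  define c1 where "c1 = (if c0 = 0 then c else 0)"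
  have r: "(c0 = 0 \<and> c1 = c) \<or> (c0 = c \<and> c1 = 0)"
    using ridge c_pos by (auto simp: c1_def)
  have W: "Wmat Sigma X = Wm X" for X :: "real^'n^'p"
    by (simp add: Wmat_def Wm_def centred_eq flip: P_def)
  have al: "alpha (Wm X) = c0 * w X + c1" for X
    using ridge c_pos by (auto simp: c1_def trace_Wm)
  define g where "g X = a *\<^sub>R G c0 c1 X + b *\<^sub>R F 0 X" for X
  have est: "RLS alpha a b Sigma X = X - g X" for X
    by (simp add: RLS_def Let_def W al centred_eq g_def G_def F_def V_def trace_Wm mm.add_left mm.scaleR_left)
  let ?np = "real CARD('n) * real CARD('p)"
  let ?Delta = "Delta_hat alpha c0 a b Sigma :: real^'n^'p \<Rightarrow> real"
  let ?U = "{X. w X \<noteq> 0}"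
  let ?R = "\<lambda>X. indicator ?U X * (2 * f X * (g X \<bullet> (P ** (X - Theta)) - (a * D c0 c1 X + b * ((m - 2) / w X))))"
  have lossR: "?np * loss Sigma Theta (RLS alpha a b Sigma X) = qf (X - g X - Theta)" for X
    by (simp add: loss_eq est P_def)
  have loss0: "?np * loss Sigma Theta X = qf (X - Theta)" for X
    by (simp add: loss_eq P_def)
  have np: "?np > 0" by simp
  have sets: "borel_measurable (matnormal Theta Sigma) = borel_measurable borel"
    by (simp add: mn cong: measurable_cong_sets)
  have mD [measurable]: "?Delta \<in> borel_measurable borel"
    using borel_measurable_integrable[OF int_Delta] unfolding sets .
  have mL [measurable]: "(\<lambda>X. loss Sigma Theta (RLS alpha a b Sigma X)) \<in> borel_measurable borel"
    using borel_measurable_integrable[OF int_loss] unfolding sets .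
  have m0 [measurable]: "(\<lambda>X. loss Sigma Theta X) \<in> borel_measurable borel"
  proof -
    have "(\<lambda>X. loss Sigma Theta X) = (\<lambda>X. qf (X - Theta) / ?np)"
      using loss0 np by (simp add: fun_eq_iff field_simps)
    then show ?thesis by simp
  qed
  have iD: "integrable lborel (\<lambda>X. f X * ?Delta X)"
    using int_Delta mn_int[OF mD] by simp
  have "integrable lborel (\<lambda>X. ?np * (f X * loss Sigma Theta (RLS alpha a b Sigma X)))"
    using int_loss mn_int[OF mL] by simp
  then have iL: "integrable lborel (\<lambda>X. f X * qf (X - g X - Theta))"
    by (simp add: lossR[symmetric] mult.left_commute)
  have R: "has_bochner_integral lborel ?R 0"
    using stein_combined[OF c_pos r, of a b] iL unfolding g_def by simp
  \<comment> \<open>The term \<open>4 * b / trace W\<close> of the estimator is the source of the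
    \<open>- 2\<close> in \<open>m - 2\<close>; the terms linear in \<open>a\<close> alone add up to
    \<open>- 2 * a * D\<close>.\<close>
  have Delta: "?Delta X = qf (g X) - 2 * (a * D c0 c1 X + b * ((m - 2) / w X))" if nz: "w X \<noteq> 0" for X
  proof -
    have p: "c0 * w X + c1 > 0"
      using r c_pos nz w_nonneg[of X] by (auto simp: less_le)
    let ?V = "V (c0 * w X + c1) X"
    have "qf (g X) = a\<^sup>2 * qf (G c0 c1 X) + 2 * (a * b * (G c0 c1 X \<bullet> (P ** F 0 X))) + b\<^sup>2 * (1 / w X)"
      unfolding g_def qf_add qf_scaleR qf_F0 by (simp add: mm.scaleR_right)
    moreover have "qf (G c0 c1 X) = trace (?V ** ?V ** Wm X)"
      unfolding G_def by (rule inner_VY[OF p])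
    moreover have "G c0 c1 X \<bullet> (P ** F 0 X) = trace (?V ** Wm X) / w X"
    proof -
      have "G c0 c1 X \<bullet> (P ** Y X) = Y X \<bullet> (P ** G c0 c1 X)"
        by (metis inner_commute symP)
      also have "\<dots> = trace (?V ** Wm X)"
        unfolding G_def by (rule inner_Y)
      finally show ?thesis
        by (simp add: F_def mm.scaleR_right)
    qed
    ultimately show ?thesis
      unfolding Delta_hat_def Let_def W al trace_Wm D_def m_def V_def
      by (simp add: algebra_simps add_divide_distrib diff_divide_distrib power2_eq_square)
  qed
  \<comment> \<open>Expanding the loss of \<open>X - g X\<close> cancels both
    \<open>qf (g X)\<close> and \<open>qf (X - Theta)\<close>; what remains is twice the Stein
    difference of \<open>g\<close>, whose integral is 0.\<close>
  have "(\<integral>X. f X * ?Delta X - f X * qf (X - g X - Theta) + f X * qf (X - Theta) \<partial>lborel) = integral\<^sup>L lborel ?R"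
  proof (rule integral_cong_AE)
    show "(\<lambda>X. f X * ?Delta X - f X * qf (X - g X - Theta) + f X * qf (X - Theta)) \<in> borel_measurable lborel"
      using iD iL integrable_qf by (auto dest!: borel_measurable_integrable)
    show "?R \<in> borel_measurable lborel"
      using R by (auto simp: has_bochner_integral_iff dest: borel_measurable_integrable)
    show "AE X in lborel. f X * ?Delta X - f X * qf (X - g X - Theta) + f X * qf (X - Theta) = ?R X"
      using AE_w_nonzero
    proof eventually_elim
      fix X assume nz: "w X \<noteq> 0"
      have "qf (X - g X - Theta) = qf ((X - Theta) - g X)"
        by (simp add: algebra_simps)
      also have "\<dots> = qf (X - Theta) - 2 * (g X \<bullet> (P ** (X - Theta))) + qf (g X)"
        by (rule qf_diff)
      finally have e: "qf (X - g X - Theta) = qf (X - Theta) - 2 * (g X \<bullet> (P ** (X - Theta))) + qf (g X)" .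
      have alg: "r * (C - 2 * S) - r * (A - 2 * B + C) + r * A = 2 * r * (B - S)" for r A B C S :: real
        by (simp add: algebra_simps)
      have U: "indicator ?U X = (1 :: real)"
        using nz by simp
      show "f X * ?Delta X - f X * qf (X - g X - Theta) + f X * qf (X - Theta) = ?R X"
        unfolding e Delta[OF nz] U mult_1_left by (rule alg)
    qed
  qed
  then have "(\<integral>X. f X * ?Delta X \<partial>lborel) - (\<integral>X. f X * qf (X - g X - Theta) \<partial>lborel)
      + (\<integral>X. f X * qf (X - Theta) \<partial>lborel) = 0"
    using iD iL integrable_qf R by (simp add: has_bochner_integral_iff)
  moreover have "(\<integral>X. f X * qf (X - g X - Theta) \<partial>lborel)
      = ?np * (\<integral>X. f X * loss Sigma Theta (RLS alpha a b Sigma X) \<partial>lborel)"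
    unfolding lossR[symmetric] integral_mult_right_zero[symmetric] by (simp only: mult_ac)
  moreover have "(\<integral>X. f X * qf (X - Theta) \<partial>lborel) = ?np * (\<integral>X. f X * loss Sigma Theta X \<partial>lborel)"
    unfolding loss0[symmetric] integral_mult_right_zero[symmetric] by (simp only: mult_ac)
  ultimately have I: "(\<integral>X. f X * ?Delta X \<partial>lborel)
      = ?np * ((\<integral>X. f X * loss Sigma Theta (RLS alpha a b Sigma X) \<partial>lborel) - (\<integral>X. f X * loss Sigma Theta X \<partial>lborel))"
    by (simp add: algebra_simps)
  then show ?thesis
    unfolding risk_def mn_integral[OF mD] mn_integral[OF mL] mn_integral[OF m0] I
    by (simp only: right_diff_distrib mult_ac)
qed

end
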